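(* Let $k\ge 1$, let $A\in GL_k(\mathbf{Q})\cap M_k(\mathbf{Z})$, let $d$ be the degree of the minimum polynomial of $A$, and let $\lambda_1,\dots,\lambda_d,\dots,\lambda_k\in\mathbf{C}^{*}$ be the eigenvalues of $A$ (with multiplicity), listed so that $\lambda_1,\dots,\lambda_d$ are the roots, with multiplicity, of the minimum polynomial. Suppose that for every $i=1,\dots,k$ there is an integer $l_i\ge 1$ such that $\lambda_i^{l_i}$ is a positive integer, that $|\lambda_1|=1$, and that $|\lambda_i|>1$ for all $i=2,\dots,d$. Let $\mu$ be a probability distribution on $\mathbf{Z}^k$ whose support is not parallel to a proper subspace of $\mathbf{Q}^k$ invariant under $A$, let $\{\mathbf{B}_n\}_{n\ge 0}$ be independent random vectors in $\mathbf{Z}^k$ with common law $\mu$, and let $\mathbf{x}_0\in\mathbf{Z}^k$. For each modulus $p$ let $\mathbf{X}_{n+1}=A\mathbf{X}_n+\mathbf{B}_n$ (mod $p$), $\mathbf{X}_0=\mathbf{x}_0$, and let $P_n$ be the law of $\mathbf{X}_n$ on $\mathbf{Z}_p^k$. Let $B=(\mathbf{y}_1\,\dots\,\mathbf{y}_k)$ be a matrix whose columns form a basis of $\mathbf{Q}^k$ contained in $V^{d-1}$. Then there exist $\alpha,c\in\mathbf{R}^{+}$ and $N\in\mathbf{N}$ such that, for all $p\in\mathbf{N}$ with $p>N$ and $\gcd(\det(A),p)=\gcd(\det(B),p)=1$, and for all integers $n\ge cp^2$, $$\|P_n-U\|\le 2^{k-1}\exp\left(-\frac{\alpha n}{p^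2}\right).$$
   Context: $\mathbf{Z}_p^k=(\mathbf{Z}/p\mathbf{Z})^k$; $U$ is the uniform distribution on $\mathbf{Z}_p^k$; $\|P_n-U\|=\frac12\sum_{\mathbf{x}\in\mathbf{Z}_p^k}|P_n(\mathbf{x})-U(\mathbf{x})|$ is the variation distance. The support of $\mu$ is parallel to a subspace $W\subset\mathbf{Q}^k$ if it is contained in some translate $\mathbf{v}+W$; "proper" means $W\neq\mathbf{Q}^k$ (so $W=\{\mathbf 0\}$ is allowed). Set $V=\{\mathbf{h}-\mathbf{k}:\mathbf{h},\mathbf{k}\in\operatorname{supp}\mu\}$ and $V^{d-1}=\{A^m\mathbf{x}:\mathbf{x}\in V,\ m=0,1,\dots,d-1\}$. Under the hypothesis on the support of $\mu$, $V^{d-1}$ contains a basis of $\mathbf{Q}^k$; one such basis $\{\mathbf{y}_1,\dots,\mathbf{y}_k\}$ is fixed and $B$ is the integer matrix with these columns. For $i=d+1,\dots,k$ one has $\lambda_i\in\{\lambda_1,\dots,\lambda_d\}$. The matrix $A$, the law $\mu$ and the vector $\mathbf{x}_0$ do not depend on $p$. *)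

theory Defs
  imports "HOL-Probability.Probability" "HOL-Computational_Algebra.Polynomial"
begin

(* Matrix powers are spelled out, since the power M ^ m of the type class instance for vectors
   is taken entry by entry. *)
primrec mat_power :: "'a::semiring_1 ^ 'k ^ 'k \<Rightarrow> nat \<Rightarrow> 'a ^ 'k ^ 'k" where
  "mat_power M 0 = mat 1"
| "mat_power M (Suc m) = M ** mat_power M m"

(* The factor mat c is the scalar matrix c I, so that mat c ** M is the scalar multiple c M. *)
definition poly_mat :: "'a::comm_ring_1 poly \<Rightarrow> 'a ^ 'k ^ 'k \<Rightarrow> 'a ^ 'k ^ 'k" where
  "poly_mat q M = (\<Sum>i\<le>degree q. mat (coeff q i) ** mat_power M i)"

definition is_minimum_poly :: "'a::field ^ 'k ^ 'k \<Rightarrow> 'a poly \<Rightarrow> bool" where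
  "is_minimum_poly M q \<longleftrightarrow>
     lead_coeff q = 1 \<and> poly_mat q M = 0 \<and>
     (\<forall>r. r \<noteq> 0 \<longrightarrow> poly_mat r M = 0 \<longrightarrow> degree q \<le> degree r)"

(* det (X I - M), over the polynomial ring *)
definition charpoly :: "'a::comm_ring_1 ^ 'k ^ 'k \<Rightarrow> 'a poly" where
  "charpoly M = det (mat [:0, 1:] - map_matrix (\<lambda>a. [:a:]) M)"

definition rat_vec :: "int ^ 'k \<Rightarrow> rat ^ 'k" where
  "rat_vec x = (\<chi> i. of_int (x $ i))"

definition rat_mat :: "int ^ 'k ^ 'k \<Rightarrow> rat ^ 'k ^ 'k" where
  "rat_mat M = map_matrix of_int M"

definition parallel_to :: "(int ^ 'k) set \<Rightarrow> (rat ^ 'k) set \<Rightarrow> bool" where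
  "parallel_to S W \<longleftrightarrow> (\<exists>v. rat_vec ` S \<subseteq> (\<lambda>w. v + w) ` W)"

definition invariant_under :: "'a::semiring_1 ^ 'k ^ 'k \<Rightarrow> ('a ^ 'k) set \<Rightarrow> bool" where
  "invariant_under M W \<longleftrightarrow> (\<forall>w\<in>W. M *v w \<in> W)"

definition support_differences :: "(int ^ 'k) pmf \<Rightarrow> (int ^ 'k) set" where
  "support_differences \<mu> = {h - k | h k. h \<in> set_pmf \<mu> \<and> k \<in> set_pmf \<mu>}"

(* The set written V^(d-1) *)
definition iterated_differences ::
    "int ^ 'k ^ 'k \<Rightarrow> nat \<Rightarrow> (int ^ 'k) pmf \<Rightarrow> (int ^ 'k) set" where
  "iterated_differences A d \<mu> =
     {mat_power A m *v x | m x. m < d \<and> x \<in> support_differences \<mu>}"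

(* The columns are collected in a set, but a spanning set has at least CARD('k) elements,
   so the columns are necessarily distinct. *)
definition columns_form_basis :: "int ^ 'k ^ 'k \<Rightarrow> bool" where
  "columns_form_basis B \<longleftrightarrow>
     vec.independent (columns (rat_mat B)) \<and> vec.span (columns (rat_mat B)) = UNIV"

(* (Z/pZ)^k is represented by the integer vectors with entries in {0, ..., p - 1}. *)
definition residue_vectors :: "nat \<Rightarrow> (int ^ 'k) set" where
  "residue_vectors p = {x. \<forall>i. 0 \<le> x $ i \<and> x $ i < int p}"

definition reduce_vec :: "nat \<Rightarrow> int ^ 'k \<Rightarrow> int ^ 'k" where
  "reduce_vec p x = (\<chi> i. x $ i mod int p)"

primrec walk ::
    "int ^ 'k ^ 'k \<Rightarrow> (nat \<Rightarrow> 'w \<Rightarrow> int ^ 'k) \<Rightarrow> int ^ 'k \<Rightarrow> nat \<Rightarrow> nat \<Rightarrow> 'w \<Rightarrow> int ^ 'k" where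
  "walk A b x0 p 0 \<omega> = reduce_vec p x0"
| "walk A b x0 p (Suc n) \<omega> = reduce_vec p (A *v walk A b x0 p n \<omega> + b n \<omega>)"

definition walk_law ::
    "'w measure \<Rightarrow> int ^ 'k ^ 'k \<Rightarrow> (nat \<Rightarrow> 'w \<Rightarrow> int ^ 'k) \<Rightarrow> int ^ 'k \<Rightarrow> nat \<Rightarrow> nat
      \<Rightarrow> (int ^ 'k) measure" where
  "walk_law M A b x0 p n = distr M (count_space UNIV) (walk A b x0 p n)"

definition uniform_law :: "nat \<Rightarrow> (int ^ 'k) measure" where
  "uniform_law p = measure_pmf (pmf_of_set (residue_vectors p))"

definition variation_distance ::
    "nat \<Rightarrow> (int ^ 'k) measure \<Rightarrow> (int ^ 'k) measure \<Rightarrow> real" where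
  "variation_distance p P Q =
     1 / 2 * (\<Sum>x\<in>residue_vectors p. \<bar>measure P {x} - measure Q {x}\<bar>)"

end

theory Submission
  imports Defs
begin

text \<open>
  Write \<open>S\<close> for the adjoint of \<open>A\<close> and \<open>\<chi>\<^sub>t(x) = exp (2\<pi>i \<langle>x,t\<rangle>/p)\<close> for the characters of the
  group of residue vectors. The squared variation distance to the uniform law is controlled, through
  Plancherel and Cauchy-Schwarz, by the sum over \<open>t \<noteq> 0\<close> of the squared moduli of the Fourier
  coefficients of the walk (\<open>l1_distance_uniform_le_fourier\<close>). By independence the coefficient at
  \<open>t\<close> has as modulus the product, over \<open>i < n\<close>, of the moduli of the Fourier coefficients of \<open>\<mu>\<close>
  at \<open>S\<^sup>i t\<close>, and each factor is small as soon as some difference of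
  two support points pairs with \<open>S\<^sup>i t / p\<close> to something far from an integer. Since the columns
  \<open>y\<^sub>j\<close> of \<open>B\<close> are images of such differences under powers of \<open>A\<close>, the coefficient at \<open>t\<close> is at
  most \<open>exp (- \<beta> E(t))\<close>, where the energy \<open>E(t)\<close> sums, over all times \<open>i\<close> and all columns, the
  squared distance of \<open>\<langle>y\<^sub>j, S\<^sup>i t\<rangle>/p\<close> to the nearest integer (\<open>fourier_decay\<close>).

  The unique root of modulus one of the minimum polynomial equals its own conjugate, hence is
  \<open>\<epsilon> = \<plusminus>1\<close>, and the minimum polynomial is \<open>(X - \<epsilon>) r\<close> with all roots of \<open>r\<close> outside the closed
  unit disc. Characters fall into two classes.

  If \<open>S t \<equiv> \<epsilon> t\<close> modulo \<open>p\<close>, the orbit of \<open>t\<close> is stationary up to sign and the energy is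
  \<open>n\<close> times a quadratic expression in the coordinates \<open>\<langle>y\<^sub>j, t\<rangle>\<close>. As \<open>det B\<close> is invertible
  modulo \<open>p\<close>, these coordinates parametrize all residue vectors, and the sum over this class is
  bounded by a product of one-dimensional Gaussian sums of width \<open>p / sqrt n\<close>
  (\<open>energy_eigenvector\<close>, \<open>gaussian_sum\<close>). This is where the rate \<open>n / p\<^sup>2\<close> comes from, and why no
  logarithm of \<open>p\<close> is lost.

  Otherwise \<open>s = S t - \<epsilon> t\<close> is nonzero modulo \<open>p\<close>, and the sequences \<open>\<langle>y\<^sub>j, S\<^sup>i s\<rangle>\<close> satisfy the
  linear recurrence with characteristic polynomial \<open>r\<close>. From a value not divisible by
  \<open>p\<close> on, such a sequence divided by \<open>p\<close> cannot stay near the integers for long: its fractional parts would satisfy the recurrence exactly, bounded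
  solutions of an expanding recurrence decay exponentially when followed backwards, and a multiple
  of \<open>1/p\<close> of modulus less than \<open>1/p\<close> vanishes (\<open>expanding_recurrence_mod_escapes\<close>). So every block
  of \<open>O(p)\<close> consecutive times contributes a fixed amount of energy (\<open>energy_expanding\<close>), and the at
  most \<open>p\<^sup>k\<close> characters of this class contribute \<open>p\<^sup>k exp (- c n / p)\<close>, which is negligible once
  \<open>n\<close> is of order \<open>p\<^sup>2\<close>.
\<close>

section \<open>Distance to the nearest integer\<close>

definition int_dist :: "real \<Rightarrow> real" where
  "int_dist x = \<bar>x - of_int (round x)\<bar>"

lemma int_dist_nonneg [simp]: "0 \<le> int_dist x"
  by (simp add: int_dist_def)

lemma int_dist_le: "int_dist x \<le> \<bar>x - of_int m\<bar>"
  unfolding int_dist_def by (rule round_diff_minimal)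

lemma int_dist_le_half: "int_dist x \<le> 1 / 2"
  unfolding int_dist_def using of_int_round_abs_le[of x] by linarith

lemma int_dist_le_add_int: "int_dist (x + of_int m) \<le> int_dist x"
  using int_dist_le[of "x + of_int m" "round x + m"] by (simp add: int_dist_def)

lemma int_dist_add_int [simp]: "int_dist (x + of_int m) = int_dist x"
  using int_dist_le_add_int[of x m] int_dist_le_add_int[of "x + of_int m" "- m"] by simp

lemma int_dist_le_minus: "int_dist (- x) \<le> int_dist x"
  using int_dist_le[of "- x" "- round x"] by (simp add: int_dist_def)

lemma int_dist_minus [simp]: "int_dist (- x) = int_dist x"
  using int_dist_le_minus[of x] int_dist_le_minus[of "- x"] by simp

lemma int_dist_diff_le: "int_dist (x - y) \<le> int_dist x + int_dist y"
proof -
  have "int_dist (x - y) \<le> \<bar>(x - y) - of_int (round x - round y)\<bar>"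
    by (rule int_dist_le)
  also have "\<dots> \<le> int_dist x + int_dist y"
    unfolding int_dist_def by simp
  finally show ?thesis .
qed

lemma int_dist_cong_mod:
  assumes "int p dvd a - b"
  shows "int_dist (of_int a / of_nat p) = int_dist (of_int b / of_nat p)"
proof (cases "p = 0")
  case False
  from assms obtain k where "a = b + int p * k"
    by (metis add.commute diff_add_cancel dvdE)
  then have "of_int a / real p = of_int b / real p + of_int k"
    using False by (simp add: field_simps)
  then show ?thesis by simp
qed auto

lemma dvd_of_int_dist_less:
  assumes "p > 0" "int_dist (of_int a / of_nat p) < 1 / of_nat p"
  shows "int p dvd a"
proof -
  define r where "r = round (of_int a / real p)"
  have "real_of_int a / real p - of_int r = of_int (a - r * int p) / real p"
    using assms(1) by (simp add: field_simps)
  then have "\<bar>real_of_int (a - r * int p)\<bar> / real p < 1 / real p"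
    using assms unfolding int_dist_def r_def[symmetric] by simp
  then have "\<bar>real_of_int (a - r * int p)\<bar> < 1"
    using assms(1) by (simp add: divide_less_cancel)
  then have "a = r * int p" by linarith
  then show ?thesis by simp
qed

text \<open>
  The cosine only depends, up to sign, on the distance \<open>z \<le> 1/2\<close> to the nearest integer, and
  \<open>cos (\<pi>z) = 1 - 2 sin\<^sup>2 (\<pi>z/2)\<close>. The crude bound \<open>sin y \<ge> y/2\<close>, valid while \<open>cos \<ge> 1/2\<close>, suffices
  because \<open>\<pi>\<^sup>2 \<ge> 8\<close>.
\<close>

lemma abs_cos_pi_le: "\<bar>cos (pi * x)\<bar> \<le> 1 - (int_dist x)\<^sup>2"
proof -
  define z where "z = int_dist x"
  have z: "0 \<le> z" "z \<le> 1 / 2"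
    unfolding z_def by (rule int_dist_nonneg, rule int_dist_le_half)
  have "\<bar>cos (pi * x)\<bar> = \<bar>cos (pi * (x - of_int (round x)))\<bar>"
  proof -
    have "sin (pi * of_int (round x)) = 0"
      by (subst sin_zero_iff_int2) (auto simp: mult.commute)
    then have "cos (pi * (x - of_int (round x))) = cos (pi * x) * cos (pi * of_int (round x))"
      by (simp add: right_diff_distrib cos_diff)
    moreover have "\<bar>cos (pi * of_int (round x))\<bar> = 1"
      using \<open>sin (pi * of_int (round x)) = 0\<close> by (rule sin_zero_abs_cos_one)
    ultimately show ?thesis by (simp add: abs_mult)
  qed
  also have "\<dots> = \<bar>cos (pi * z)\<bar>"
    unfolding z_def int_dist_def by (cases "0 \<le> x - of_int (round x)") (simp_all only: abs_of_nonneg abs_of_neg not_le mult_minus_right cos_minus)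
  also have "\<dots> = cos (pi * z)"
  proof (intro abs_of_nonneg cos_ge_zero)
    show "pi * z \<le> pi / 2" using z mult_left_mono[of z "1/2" pi] by simp
    have "0 \<le> pi * z" using z by simp
    then show "- (pi / 2) \<le> pi * z" using pi_gt_zero by linarith
  qed
  also have "\<dots> \<le> 1 - z\<^sup>2"
  proof -
    define y where "y = pi * z / 2"
    have y: "0 \<le> y" "y \<le> pi / 3" using z pi_gt_zero by (auto simp: y_def field_simps)
    have "y / 2 \<le> sin y"
    proof (cases "y = 0")
      case False
      with y have "\<exists>w. 0 < w \<and> w < y \<and> sin y - sin 0 = (y - 0) * cos w"
        by (intro MVT2) (auto intro!: derivative_eq_intros)
      then obtain w where w: "0 < w" "w < y" "sin y = y * cos w" by auto
      have "cos (pi / 3) \<le> cos w"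
        using w y by (intro cos_monotone_0_pi_le) auto
      then have "1 / 2 \<le> cos w" by (simp add: cos_60)
      then show ?thesis using w y mult_left_mono[of "1/2" "cos w" y] by simp
    qed simp
    then have "(y / 2)\<^sup>2 \<le> (sin y)\<^sup>2" using y by (intro power_mono) auto
    moreover have "z\<^sup>2 / 2 \<le> (y / 2)\<^sup>2"
    proof -
      have "3\<^sup>2 \<le> pi\<^sup>2" using pi_gt3 by (intro power_mono) auto
      then have "9 * z\<^sup>2 \<le> pi\<^sup>2 * z\<^sup>2" by (intro mult_right_mono) auto
      then have "8 * z\<^sup>2 \<le> pi\<^sup>2 * z\<^sup>2" using zero_le_power2[of z] by linarith
      then show ?thesis by (simp add: y_def power_mult_distrib power_divide)
    qed
    moreover have "cos (pi * z) = 1 - 2 * (sin y)\<^sup>2"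
      using cos_double_sin[of y] by (simp add: y_def)
    ultimately show ?thesis by linarith
  qed
  finally show ?thesis by (simp add: z_def)
qed

section \<open>Expanding linear recurrences modulo p\<close>

text \<open>
  The polynomial \<open>P\<close> in the shift operator, applied to the sequence \<open>z\<close>. A sequence killed by
  \<open>P\<close> is a solution of the linear recurrence with characteristic polynomial \<open>P\<close>, and products of
  polynomials act by composition.
\<close>

definition shift_eval :: "'a::comm_ring_1 poly \<Rightarrow> (nat \<Rightarrow> 'a) \<Rightarrow> nat \<Rightarrow> 'a" where
  "shift_eval P z i = (\<Sum>j\<le>degree P. coeff P j * z (i + j))"

lemma shift_eval_sum_atMost:
  assumes "degree P \<le> N"
  shows "shift_eval P z i = (\<Sum>j\<le>N. coeff P j * z (i + j))"
  unfolding shift_eval_def using assms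
  by (intro sum.mono_neutral_left) (auto simp: coeff_eq_0)

lemma shift_eval_0 [simp]: "shift_eval 0 z i = 0"
  by (simp add: shift_eval_def)

lemma shift_eval_1 [simp]: "shift_eval 1 z i = z i"
  by (simp add: shift_eval_def)

lemma shift_eval_pCons [simp]:
  "shift_eval (pCons a P) z i = a * z i + shift_eval P z (Suc i)"
proof -
  have "shift_eval (pCons a P) z i = (\<Sum>j\<le>Suc (degree P). coeff (pCons a P) j * z (i + j))"
    by (rule shift_eval_sum_atMost) (rule degree_pCons_le)
  also have "\<dots> = a * z i + (\<Sum>j\<le>degree P. coeff P j * z (Suc i + j))"
    by (simp add: sum.atMost_Suc_shift del: sum.atMost_Suc)
  finally show ?thesis by (simp add: shift_eval_def)
qed

lemma shift_eval_add: "shift_eval (P + Q) z i = shift_eval P z i + shift_eval Q z i"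
proof -
  define N where "N = max (degree P) (degree Q)"
  have "degree (P + Q) \<le> N" "degree P \<le> N" "degree Q \<le> N"
    by (auto simp: N_def degree_add_le_max)
  then show ?thesis
    by (simp add: shift_eval_sum_atMost[where N = N] sum.distrib algebra_simps)
qed

lemma shift_eval_smult: "shift_eval (smult c P) z i = c * shift_eval P z i"
  by (subst (1 2) shift_eval_sum_atMost[where N = "degree P"])
    (simp_all add: sum_distrib_left mult.assoc degree_smult_le)

lemma shift_eval_mult: "shift_eval (P * Q) z i = shift_eval P (shift_eval Q z) i"
  by (induction P arbitrary: i) (simp_all add: shift_eval_add shift_eval_smult)

text \<open>
  The \<open>\<ell>\<^sup>1\<close> norm of the coefficients. It is submultiplicative and bounds the operator norm of
  \<open>shift_eval P\<close> on bounded sequences.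
\<close>

definition coeff_norm_sum :: "complex poly \<Rightarrow> real" where
  "coeff_norm_sum P = (\<Sum>j\<le>degree P. cmod (coeff P j))"

lemma coeff_norm_sum_atMost:
  assumes "degree P \<le> N"
  shows "coeff_norm_sum P = (\<Sum>j\<le>N. cmod (coeff P j))"
  unfolding coeff_norm_sum_def using assms
  by (intro sum.mono_neutral_left) (auto simp: coeff_eq_0)

lemma coeff_norm_sum_nonneg [simp]: "0 \<le> coeff_norm_sum P"
  by (simp add: coeff_norm_sum_def sum_nonneg)

lemma coeff_norm_sum_0 [simp]: "coeff_norm_sum 0 = 0"
  by (simp add: coeff_norm_sum_def)

lemma coeff_norm_sum_pCons [simp]: "coeff_norm_sum (pCons a P) = cmod a + coeff_norm_sum P"
proof -
  have "coeff_norm_sum (pCons a P) = (\<Sum>j\<le>Suc (degree P). cmod (coeff (pCons a P) j))"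
    by (rule coeff_norm_sum_atMost) (rule degree_pCons_le)
  then show ?thesis by (simp add: sum.atMost_Suc_shift coeff_norm_sum_def del: sum.atMost_Suc)
qed

lemma coeff_norm_sum_add_le: "coeff_norm_sum (P + Q) \<le> coeff_norm_sum P + coeff_norm_sum Q"
proof -
  define N where "N = max (degree P) (degree Q)"
  have "degree (P + Q) \<le> N" "degree P \<le> N" "degree Q \<le> N"
    by (auto simp: N_def degree_add_le_max)
  then show ?thesis
    by (simp add: coeff_norm_sum_atMost[where N = N] sum.distrib[symmetric] sum_mono norm_triangle_ineq)
qed

lemma coeff_norm_sum_smult [simp]: "coeff_norm_sum (smult c P) = cmod c * coeff_norm_sum P"
  by (simp add: coeff_norm_sum_atMost[where N = "degree P"] sum_distrib_left norm_mult)

lemma coeff_norm_sum_mult_le: "coeff_norm_sum (P * Q) \<le> coeff_norm_sum P * coeff_norm_sum Q"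
proof (induction P)
  case (pCons a P)
  have "coeff_norm_sum (pCons a P * Q) \<le> coeff_norm_sum (smult a Q) + coeff_norm_sum (pCons 0 (P * Q))"
    unfolding mult_pCons_left by (rule coeff_norm_sum_add_le)
  with pCons.IH show ?case by (simp add: algebra_simps)
qed simp

lemma norm_shift_eval_le:
  assumes "\<And>j. j \<le> degree P \<Longrightarrow> cmod (z (i + j)) \<le> M"
  shows "cmod (shift_eval P z i) \<le> coeff_norm_sum P * M"
proof -
  have "cmod (shift_eval P z i) \<le> (\<Sum>j\<le>degree P. cmod (coeff P j * z (i + j)))"
    unfolding shift_eval_def by (rule norm_sum)
  also have "\<dots> \<le> (\<Sum>j\<le>degree P. cmod (coeff P j) * M)"
    using assms by (intro sum_mono) (auto simp: norm_mult intro!: mult_left_mono)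
  finally show ?thesis by (simp add: coeff_norm_sum_def sum_distrib_right)
qed

text \<open>
  If all roots of \<open>r\<close> lie outside the closed unit disc, then \<open>1/r\<close> is a power series with
  summable coefficients, so truncating it inverts \<open>r\<close> up to a small error in the \<open>\<ell>\<^sup>1\<close> norm. For a
  single factor the truncated geometric series leaves the error \<open>(X/\<lambda>)\<^sup>m\<close>; the errors \<open>e\<^sub>1\<close> and
  \<open>e\<^sub>2\<close> of two factors combine to \<open>e\<^sub>1 + e\<^sub>2 - e\<^sub>1 e\<^sub>2\<close>.
\<close>

lemma expanding_poly_near_inverse:
  fixes ev :: "'i \<Rightarrow> complex"
  assumes "finite I" "\<And>i. i \<in> I \<Longrightarrow> cmod (ev i) > 1" "\<eta> > 0"
  shows "\<exists>h. coeff_norm_sum (1 - (\<Prod>i\<in>I. [:- ev i, 1:]) * h) \<le> \<eta>"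
  using assms
proof (induction I arbitrary: \<eta> rule: finite_induct)
  case empty
  then show ?case by (intro exI[of _ 1]) simp
next
  case (insert a I)
  define P where "P = (\<Prod>i\<in>I. [:- ev i, 1:])"
  define \<epsilon> where "\<epsilon> = min 1 (\<eta> / 3)"
  have \<epsilon>: "\<epsilon> > 0" "\<epsilon> \<le> 1" "3 * \<epsilon> \<le> \<eta>" using insert.prems by (auto simp: \<epsilon>_def)
  obtain h where h: "coeff_norm_sum (1 - P * h) \<le> \<epsilon>"
    using insert.IH[of \<epsilon>] insert.prems \<epsilon> by (auto simp: P_def)
  have a: "cmod (ev a) > 1" using insert.prems by simp
  define u where "u = inverse (ev a)"
  have "ev a \<noteq> 0" using a by auto
  then have u: "cmod u < 1" "u * ev a = 1"
    using a by (simp_all add: u_def norm_inverse inverse_less_1_iff)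
  obtain m where m: "cmod u ^ m < \<epsilon>" using real_arch_pow_inv[OF \<epsilon>(1) u(1)] by auto
  define g where "g = smult (- u) (\<Sum>j<m. [:0, u:] ^ j)"
  have lin: "[:- ev a, 1:] * g = 1 - [:0, u:] ^ m"
  proof -
    have "[:- ev a, 1:] * g = (1 - [:0, u:]) * (\<Sum>j<m. [:0, u:] ^ j)"
    proof -
      have "smult (- u) [:- ev a, 1:] = 1 - [:0, u:]"
        using u(2) by (simp add: one_pCons)
      then show ?thesis unfolding g_def by (metis mult_smult_left mult_smult_right)
    qed
    then show ?thesis by (simp add: one_diff_power_eq)
  qed
  have pw: "coeff_norm_sum ([:0, u:] ^ m) \<le> cmod u ^ m" for m
  proof (induction m)
    case 0 show ?case by (simp add: one_pCons)
  next
    case (Suc m)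
    have "coeff_norm_sum ([:0, u:] ^ Suc m) \<le> coeff_norm_sum [:0, u:] * coeff_norm_sum ([:0, u:] ^ m)"
      unfolding power_Suc by (rule coeff_norm_sum_mult_le)
    also have "\<dots> \<le> cmod u * cmod u ^ m" using Suc by (simp add: mult_left_mono)
    finally show ?case by simp
  qed
  define e1 where "e1 = [:0, u:] ^ m"
  define e2 where "e2 = 1 - P * h"
  have e: "coeff_norm_sum e1 \<le> \<epsilon>" "coeff_norm_sum e2 \<le> \<epsilon>"
    using pw[of m] m h by (auto simp: e1_def e2_def)
  have "(\<Prod>i\<in>insert a I. [:- ev i, 1:]) * (g * h) = ([:- ev a, 1:] * g) * (P * h)"
    unfolding prod.insert[OF insert.hyps] P_def[symmetric] by (simp only: mult_ac)
  also have "\<dots> = (1 - e1) * (1 - e2)" unfolding lin by (simp add: e1_def e2_def)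
  finally have "1 - (\<Prod>i\<in>insert a I. [:- ev i, 1:]) * (g * h) = e1 + (e2 + smult (- 1) (e1 * e2))"
    by (simp add: algebra_simps)
  also have "coeff_norm_sum \<dots> \<le> coeff_norm_sum e1 + (coeff_norm_sum e2 + coeff_norm_sum (smult (- 1) (e1 * e2)))"
    by (intro order_trans[OF coeff_norm_sum_add_le] add_left_mono coeff_norm_sum_add_le)
  also have "\<dots> \<le> \<epsilon> + (\<epsilon> + \<epsilon> * 1)"
  proof (intro add_mono e)
    have "coeff_norm_sum (smult (- 1) (e1 * e2)) \<le> coeff_norm_sum e1 * coeff_norm_sum e2"
      by (subst coeff_norm_sum_smult) (simp add: coeff_norm_sum_mult_le)
    also have "\<dots> \<le> \<epsilon> * 1" using e \<epsilon> by (intro mult_mono) auto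
    finally show "coeff_norm_sum (smult (- 1) (e1 * e2)) \<le> \<epsilon> * 1" .
  qed
  also have "\<dots> \<le> \<eta>" using \<epsilon> by simp
  finally show ?case by blast
qed

text \<open>
  Solutions of an expanding recurrence contract when followed backwards. If \<open>e = 1 - r h\<close> has
  norm at most \<open>1/2\<close>, then a solution \<open>z\<close> of \<open>r\<close> satisfies \<open>z = e z\<close>, so that \<open>z\<^sub>i\<close> is at most
  half the maximum of the next few terms; iterating \<open>m\<close> times gives the factor \<open>1/2\<^sup>m\<close>. Only a window
  of length proportional to \<open>m\<close> enters, so the recurrence may fail elsewhere.
\<close>

lemma expanding_recurrence_decay:
  fixes ev :: "'i \<Rightarrow> complex"
  assumes "finite I" "\<And>i. i \<in> I \<Longrightarrow> cmod (ev i) > 1"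
  defines "r \<equiv> (\<Prod>i\<in>I. [:- ev i, 1:])"
  shows "\<exists>E. \<forall>z M m i. (\<forall>j \<le> E * m. cmod (z (i + j)) \<le> M \<and> shift_eval r z (i + j) = 0)
           \<longrightarrow> cmod (z i) \<le> M / 2 ^ m"
proof -
  obtain h where h: "coeff_norm_sum (1 - r * h) \<le> 1 / 2"
    using expanding_poly_near_inverse[of I ev "1/2", OF assms(1,2), folded r_def] by auto
  define e where "e = 1 - r * h"
  define E where "E = degree h + degree e"
  have step: "cmod (z i) \<le> M / 2"
    if "\<And>j. j \<le> E \<Longrightarrow> cmod (z (i + j)) \<le> M \<and> shift_eval r z (i + j) = 0" for z M i
  proof -
    have "1 = e + h * r" by (simp add: e_def mult.commute)
    then have "z i = shift_eval (e + h * r) z i" by (metis shift_eval_1)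
    also have "\<dots> = shift_eval e z i + shift_eval h (shift_eval r z) i"
      by (simp add: shift_eval_add shift_eval_mult)
    also have "shift_eval h (shift_eval r z) i = 0"
      unfolding shift_eval_def[of h] using that by (intro sum.neutral) (auto simp: E_def)
    finally have "cmod (z i) \<le> coeff_norm_sum e * M"
      using norm_shift_eval_le[of e z i M] that by (auto simp: E_def)
    also have "\<dots> \<le> 1 / 2 * M"
    proof -
      have "cmod (z i) \<le> M" using that[of 0] by simp
      then have "0 \<le> M" by (rule order_trans[OF norm_ge_zero])
      then show ?thesis using h by (intro mult_right_mono) (auto simp: e_def)
    qed
    finally show ?thesis by simp
  qed
  have "cmod (z i) \<le> M / 2 ^ m"
    if "\<And>j. j \<le> E * m \<Longrightarrow> cmod (z (i + j)) \<le> M \<and> shift_eval r z (i + j) = 0" for z M m i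
    using that
  proof (induction m arbitrary: i)
    case 0
    then show ?case by (metis add_0_right div_by_1 le0 power_0)
  next
    case (Suc m)
    have "cmod (z i) \<le> (M / 2 ^ m) / 2"
    proof (rule step)
      fix j assume j: "j \<le> E"
      have "cmod (z (i + j)) \<le> M / 2 ^ m"
        using Suc.prems[of "j + _"] j by (intro Suc.IH) (simp add: add.assoc)
      moreover have "shift_eval r z (i + j) = 0"
        using Suc.prems[of j] j by simp
      ultimately show "cmod (z (i + j)) \<le> M / 2 ^ m \<and> shift_eval r z (i + j) = 0" by simp
    qed
    then show ?case by (simp add: mult.commute)
  qed
  then show ?thesis by blast
qed

text \<open>
  Suppose that \<open>a/p\<close> stays within \<open>\<delta>\<close> of the integers on a window. Its fractional parts \<open>z\<close>
  satisfy the recurrence up to rounding errors, which become integers after clearing denominators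
  by \<open>D\<close>; being of modulus less than one, they vanish. Then \<open>z\<close> is a true solution on the window, and
  the backward contraction makes \<open>z\<^sub>i\<close> smaller than \<open>1/p\<close>, hence zero. A window of logarithmic length
  would do; a multiple of \<open>p\<close> is simpler and costs nothing against the final rate.
\<close>

lemma expanding_recurrence_mod_escapes:
  fixes ev :: "'i \<Rightarrow> complex" and D :: int
  assumes "finite I" "\<And>i. i \<in> I \<Longrightarrow> cmod (ev i) > 1"
  defines "r \<equiv> (\<Prod>i\<in>I. [:- ev i, 1:])"
  assumes D: "D > 0" "\<And>j. of_int D * coeff r j \<in> \<int>"
  shows "\<exists>\<delta>>0. \<exists>K::nat. \<forall>p>0. \<forall>a :: nat \<Rightarrow> int. \<forall>i.
           (\<forall>i. shift_eval r (\<lambda>i. of_int (a i)) i = 0) \<longrightarrow> \<not> int p dvd a i \<longrightarrow>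
           (\<exists>j \<le> K * p. \<delta> \<le> int_dist (of_int (a (i + j)) / of_nat p))"
proof -
  obtain E where E: "\<And>z M m i. (\<And>j. j \<le> E * m \<Longrightarrow> cmod (z (i + j)) \<le> M \<and> shift_eval r z (i + j) = 0)
           \<Longrightarrow> cmod (z i) \<le> M / 2 ^ m"
    using expanding_recurrence_decay[of I ev, OF assms(1,2), folded r_def] by metis
  define \<delta> where "\<delta> = 1 / (2 * (of_int D * (coeff_norm_sum r + 1)))"
  have pos: "0 < of_int D * (coeff_norm_sum r + 1)"
    using D(1) add_nonneg_pos[OF coeff_norm_sum_nonneg[of r] zero_less_one] by simp
  then have \<delta>: "\<delta> > 0" by (simp add: \<delta>_def)
  define K where "K = E + degree r"
  have "int p dvd a i"
    if p: "p > 0" and rec: "\<And>i. shift_eval r (\<lambda>i. of_int (a i)) i = 0"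
      and small: "\<And>j. j \<le> K * p \<Longrightarrow> int_dist (of_int (a (i + j)) / of_nat p) < \<delta>"
    for p :: nat and a :: "nat \<Rightarrow> int" and i
  proof -
    define w where "w j = round (of_int (a j) / real p)" for j
    define z :: "nat \<Rightarrow> complex" where "z j = of_int (a j) / of_nat p - of_int (w j)" for j
    have cz: "cmod (z j) = int_dist (of_int (a j) / real p)" for j
    proof -
      have "z j = of_real (of_int (a j) / real p - of_int (w j))" by (simp add: z_def)
      then show ?thesis by (simp only: norm_of_real int_dist_def w_def)
    qed
    \<comment> \<open>On the window the rounding errors cancel, so the recurrence holds exactly.\<close>
    have zrec: "shift_eval r z (i + j) = 0" if j: "j \<le> E * p" for j
    proof -
      have "shift_eval r z (i + j)
          = shift_eval r (\<lambda>j. of_int (a j)) (i + j) / of_nat p - shift_eval r (\<lambda>j. of_int (w j)) (i + j)"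
        unfolding shift_eval_def z_def
        by (simp add: sum_subtractf sum_divide_distrib right_diff_distrib)
      also have "\<dots> = - shift_eval r (\<lambda>j. of_int (w j)) (i + j)"
        by (simp only: rec) simp
      finally have "of_int D * shift_eval r z (i + j)
          = - (\<Sum>l\<le>degree r. of_int D * coeff r l * of_int (w (i + j + l)))"
        by (simp only:) (simp add: shift_eval_def sum_distrib_left mult.assoc)
      moreover have "\<dots> \<in> \<int>"
        by (intro Ints_minus Ints_sum Ints_mult[OF D(2)] Ints_of_int)
      ultimately have int: "of_int D * shift_eval r z (i + j) \<in> \<int>" by simp
      have "cmod (shift_eval r z (i + j)) \<le> coeff_norm_sum r * \<delta>"
      proof (rule norm_shift_eval_le)
        fix l assume "l \<le> degree r"
        moreover have "degree r \<le> degree r * p" using p by simp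
        ultimately have "l \<le> degree r * p" by (rule le_trans)
        then have "j + l \<le> K * p" using j by (simp add: K_def distrib_right)
        then show "cmod (z (i + j + l)) \<le> \<delta>" using small[of "j + l"] by (simp add: cz add.assoc)
      qed
      then have "cmod (of_int D * shift_eval r z (i + j)) \<le> of_int D * (coeff_norm_sum r * \<delta>)"
        using D(1) by (simp add: norm_mult)
      also have "\<dots> \<le> of_int D * ((coeff_norm_sum r + 1) * \<delta>)"
        using D(1) \<delta> by (intro mult_left_mono mult_right_mono) auto
      also have "\<dots> < 1" using pos by (simp add: \<delta>_def)
      finally have "cmod (of_int D * shift_eval r z (i + j)) < 1" .
      moreover obtain m where m: "of_int D * shift_eval r z (i + j) = of_int m"
        using int by (elim Ints_cases)
      ultimately have "m = 0" unfolding m norm_of_int by linarith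
      then have "of_int D * shift_eval r z (i + j) = 0" using m by simp
      then show ?thesis using D(1) by simp
    qed
    have "cmod (z i) \<le> (1 / 2) / 2 ^ p"
      by (intro E[where m = p] conjI) (simp_all only: cz int_dist_le_half zrec)
    also have "\<dots> < 1 / real p"
    proof -
      have "real p < 2 ^ p" by (rule of_nat_less_two_power)
      then have "real p < 2 * 2 ^ p" using zero_le_power[of "2 :: real" p] by linarith
      then show ?thesis using p by (simp add: field_simps)
    qed
    finally show ?thesis using p by (intro dvd_of_int_dist_less) (simp_all add: cz)
  qed
  then show ?thesis using \<delta> by (meson not_le)
qed

section \<open>Adjoint action and invertibility modulo p\<close>

definition dot :: "'a::comm_ring_1 ^ 'k \<Rightarrow> 'a ^ 'k \<Rightarrow> 'a" where
  "dot x y = (\<Sum>i\<in>UNIV. x $ i * y $ i)"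

lemma dot_add_left: "dot (x + y) t = dot x t + dot y t"
  by (simp add: dot_def algebra_simps sum.distrib)

lemma dot_diff_left: "dot (x - y) t = dot x t - dot y t"
  by (simp add: dot_def algebra_simps sum_subtractf)

lemma dot_diff_right: "dot x (s - t) = dot x s - dot x t"
  by (simp add: dot_def algebra_simps sum_subtractf)

lemma dot_scale_right: "dot x (c *s t) = c * dot x t"
  by (simp add: dot_def sum_distrib_left algebra_simps)

lemma dot_zero_right [simp]: "dot x 0 = 0"
  by (simp add: dot_def)

lemma vector_matrix_diff: "(x - y) v* A = x v* A - (y :: 'a::comm_ring_1 ^ 'k) v* A"
  by (simp add: vec_eq_iff vector_matrix_mult_def algebra_simps sum_subtractf)

lemma vector_matrix_scale: "(c *s x) v* A = c *s ((x :: 'a::comm_ring_1 ^ 'k) v* A)"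
  by (simp add: vec_eq_iff vector_matrix_mult_def sum_distrib_left mult_ac)

lemma dot_matrix_vector: "dot (A *v x) t = dot x (t v* A)"
proof -
  have "dot (A *v x) t = (\<Sum>i\<in>UNIV. \<Sum>j\<in>UNIV. A $ i $ j * x $ j * t $ i)"
    by (simp add: dot_def matrix_vector_mult_def sum_distrib_right)
  also have "\<dots> = (\<Sum>j\<in>UNIV. \<Sum>i\<in>UNIV. A $ i $ j * x $ j * t $ i)"
    by (rule sum.swap)
  finally show ?thesis
    by (simp add: dot_def vector_matrix_mult_def sum_distrib_left algebra_simps)
qed

lemma vector_matrix_nth: "(t v* B) $ j = dot (column j B) t"
  by (simp add: dot_def vector_matrix_mult_def column_def mult.commute)

text \<open>
  Iterates of the adjoint of \<open>A\<close>, written as multiplication of row vectors by \<open>A\<close> from the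
  right.
\<close>

definition adj_iter :: "'a::comm_ring_1 ^ 'k ^ 'k \<Rightarrow> nat \<Rightarrow> 'a ^ 'k \<Rightarrow> 'a ^ 'k" where
  "adj_iter A m t = ((\<lambda>s. s v* A) ^^ m) t"

lemma adj_iter_0 [simp]: "adj_iter A 0 t = t"
  by (simp add: adj_iter_def)

lemma adj_iter_Suc: "adj_iter A (Suc m) t = adj_iter A m t v* A"
  by (simp add: adj_iter_def)

lemma adj_iter_Suc_right: "adj_iter A (Suc m) t = adj_iter A m (t v* A)"
  unfolding adj_iter_def funpow_Suc_right by simp

lemma adj_iter_add: "adj_iter A (m + n) t = adj_iter A m (adj_iter A n t)"
  by (simp add: adj_iter_def funpow_add)

lemma adj_iter_diff_scale: "adj_iter A m (s - c *s t) = adj_iter A m s - c *s adj_iter A m t"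
  by (induction m) (simp_all add: adj_iter_Suc vector_matrix_diff vector_matrix_scale)

lemma dot_mat_power: "dot (mat_power A m *v x) t = dot x (adj_iter A m t)"
proof (induction m arbitrary: t)
  case (Suc m)
  have "dot (mat_power A (Suc m) *v x) t = dot (mat_power A m *v x) (t v* A)"
    by (simp add: dot_matrix_vector flip: matrix_vector_mul_assoc)
  also have "\<dots> = dot x (adj_iter A m (t v* A))" by (rule Suc.IH)
  finally show ?case by (simp only: adj_iter_Suc_right)
qed simp

lemma dvd_dot_right:
  fixes x t :: "int ^ 'k"
  assumes "\<And>i. q dvd t $ i"
  shows "q dvd dot x t"
  unfolding dot_def using assms by (intro dvd_sum) auto

lemma det_map_matrix_of_int:
  "det (map_matrix of_int M :: 'a::comm_ring_1 ^ 'k ^ 'k) = of_int (det M)"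
  by (simp add: det_def)

lemma dvd_det_if_dvd_column:
  fixes M :: "int ^ 'k ^ 'k"
  assumes "\<And>i. q dvd M $ i $ k"
  shows "q dvd det M"
  unfolding det_def
proof (intro dvd_sum dvd_mult)
  fix \<pi> :: "'k \<Rightarrow> 'k" assume "\<pi> \<in> {\<pi>. \<pi> permutes UNIV}"
  then obtain i where i: "\<pi> i = k"
    by (metis mem_Collect_eq permutes_surj surj_def)
  have "M $ i $ \<pi> i dvd (\<Prod>i\<in>UNIV. M $ i $ \<pi> i)" by (rule dvd_prodI) auto
  with assms[of i] i show "q dvd (\<Prod>i\<in>UNIV. M $ i $ \<pi> i)" by (auto intro: dvd_trans)
qed

text \<open>
  Cramer's rule \<open>x\<^sub>k det M = det C\<close>, with \<open>M x\<close> in column \<open>k\<close> of \<open>C\<close>, transferred from the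
  field of reals to the integers: \<open>q\<close> divides that column, hence \<open>det C\<close>, and it is coprime to
  \<open>det M\<close>. The modulus need not be prime, so linear algebra over a field is not directly
  available.
\<close>

lemma dvd_vec_if_dvd_matrix_vector:
  fixes M :: "int ^ 'k ^ 'k"
  assumes "coprime (det M) q" "\<And>i. q dvd (M *v x) $ i"
  shows "q dvd x $ k"
proof -
  define C where "C = (\<chi> i j. if j = k then (M *v x) $ i else M $ i $ j)"
  let ?r = "map_matrix real_of_int"
  define x' where "x' = (\<chi> i. real_of_int (x $ i))"
  have "?r C = (\<chi> i j. if j = k then (?r M *v x') $ i else ?r M $ i $ j)"
    by (simp add: C_def vec_eq_iff matrix_vector_mult_def x'_def)
  then have "det (?r C) = x' $ k * det (?r M)" by (simp add: cramer_lemma)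
  then have "det C = x $ k * det M"
    unfolding det_map_matrix_of_int x'_def by (simp flip: of_int_mult)
  moreover have "q dvd det C"
    using assms(2) by (intro dvd_det_if_dvd_column[where k = k]) (auto simp: C_def)
  ultimately show ?thesis
    using assms(1) by (simp add: coprime_commute coprime_dvd_mult_left_iff)
qed

section \<open>Characters of the group of residue vectors\<close>

text \<open>
  Sums of products over the residue vectors factor coordinate by coordinate. This serves both
  the orthogonality of characters and the Gaussian sums.
\<close>

lemma finite_residue_vectors [simp]: "finite (residue_vectors p :: (int ^ 'k) set)"
  and sum_prod_residue_vectors:
    "(\<Sum>t\<in>(residue_vectors p :: (int ^ 'k) set). \<Prod>j\<in>UNIV. g j (t $ j))
      = (\<Prod>j\<in>UNIV. \<Sum>m\<in>{0..<int p}. (g j m :: 'a::comm_semiring_1))"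
proof -
  have bij: "bij_betw (vec_lambda :: _ \<Rightarrow> int ^ 'k) (PiE UNIV (\<lambda>_. {0..<int p})) (residue_vectors p)"
    by (rule bij_betw_byWitness[where f' = vec_nth]) (auto simp: residue_vectors_def)
  then show "finite (residue_vectors p :: (int ^ 'k) set)"
    by (metis bij_betw_finite finite finite_PiE finite_atLeastLessThan_int)
  show "(\<Sum>t\<in>(residue_vectors p :: (int ^ 'k) set). \<Prod>j\<in>UNIV. g j (t $ j))
      = (\<Prod>j\<in>UNIV. \<Sum>m\<in>{0..<int p}. g j m)"
    by (subst sum.reindex_bij_betw[OF bij, symmetric]) (simp add: prod_sum_PiE)
qed

lemma card_residue_vectors: "card (residue_vectors p :: (int ^ 'k) set) = p ^ CARD('k)"
  using sum_prod_residue_vectors[where g = "\<lambda>_ _. 1 :: nat" and 'k = 'k] by simp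

lemma zero_in_residue_vectors: "p > 0 \<Longrightarrow> 0 \<in> residue_vectors p"
  by (simp add: residue_vectors_def)

lemma residue_vectors_eqI:
  assumes "x \<in> residue_vectors p" "y \<in> residue_vectors p" "\<And>i. int p dvd (x - y) $ i"
  shows "x = y"
proof -
  have "x $ i = y $ i" for i
  proof -
    have "x $ i mod int p = y $ i mod int p"
      using assms(3)[of i] by (simp add: mod_eq_dvd_iff)
    then show ?thesis using assms(1,2) by (simp add: residue_vectors_def)
  qed
  then show ?thesis by (simp add: vec_eq_iff)
qed

lemma reduce_vec_in_residue_vectors [simp]: "p > 0 \<Longrightarrow> reduce_vec p x \<in> residue_vectors p"
  by (simp add: reduce_vec_def residue_vectors_def)

definition chi :: "nat \<Rightarrow> int ^ 'k \<Rightarrow> int ^ 'k \<Rightarrow> complex" where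
  "chi p t x = cis (2 * pi * (of_int (dot x t) / of_nat p))"

lemma norm_chi [simp]: "cmod (chi p t x) = 1"
  by (simp add: chi_def)

lemma chi_add: "chi p t (x + y) = chi p t x * chi p t y"
  by (simp add: chi_def cis_mult dot_add_left add_divide_distrib distrib_left)

lemma chi_diff: "chi p t (x - y) = chi p t x * cnj (chi p t y)"
  by (simp add: chi_def cis_mult cis_cnj dot_diff_left diff_divide_distrib right_diff_distrib)

lemma chi_matrix: "chi p t (A *v x) = chi p (t v* A) x"
  by (simp add: chi_def dot_matrix_vector)

lemma chi_zero [simp]: "chi p 0 x = 1"
  by (simp add: chi_def)

lemma cis_dvd_eq_1:
  assumes "int p dvd a"
  shows "cis (2 * pi * (of_int a / of_nat p)) = 1"
proof (cases "p = 0")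
  case False
  from assms obtain c where "a = int p * c" by (elim dvdE)
  with False show ?thesis by (simp add: cis_multiple_2pi)
qed auto

lemma chi_reduce_vec: "chi p t (reduce_vec p x) = chi p t x"
proof -
  have "int p dvd dot (x - reduce_vec p x) t"
    unfolding dot_def by (intro dvd_sum) (simp add: reduce_vec_def)
  then have "chi p t (x - reduce_vec p x) = 1" unfolding chi_def by (rule cis_dvd_eq_1)
  then have "chi p t ((x - reduce_vec p x) + reduce_vec p x) = chi p t (reduce_vec p x)"
    unfolding chi_add by simp
  then show ?thesis by simp
qed

lemma cis_sum: "cis (\<Sum>i\<in>I. f i) = (\<Prod>i\<in>I. cis (f i))"
  by (induction I rule: infinite_finite_induct) (simp_all flip: cis_mult)

lemma sum_roots_of_unity:
  assumes "p > 0"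
  shows "(\<Sum>m\<in>{0..<int p}. cis (2 * pi * (of_int (z * m) / of_nat p)))
          = (if int p dvd z then of_nat p else 0)"
proof (cases "int p dvd z")
  case True
  then have "cis (2 * pi * (of_int (z * m) / of_nat p)) = 1" for m
    by (intro cis_dvd_eq_1) simp
  then show ?thesis using True by simp
next
  case False
  define \<omega> where "\<omega> = cis (2 * pi * (of_int z / of_nat p))"
  have "\<omega> \<noteq> 1"
  proof
    assume "\<omega> = 1"
    then obtain n :: int where "2 * pi * (of_int z / of_nat p) = of_int (2 * n) * pi"
      unfolding \<omega>_def cis_conv_exp exp_eq_1 by auto
    then have "real_of_int z = of_int (n * int p)" using assms by (simp add: field_simps)
    then have "z = n * int p" by (simp only: of_int_eq_iff)
    with False show False by simp
  qed
  have "\<omega> ^ p = 1"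
    using cis_dvd_eq_1[of p "int p * z"] assms by (simp add: \<omega>_def Complex.DeMoivre algebra_simps)
  have "(\<Sum>m\<in>{0..<int p}. cis (2 * pi * (of_int (z * m) / of_nat p))) = (\<Sum>m<p. \<omega> ^ m)"
    unfolding \<omega>_def Complex.DeMoivre
    by (rule sum.reindex_bij_witness[where i = int and j = nat]) (auto simp: algebra_simps)
  also have "\<dots> = 0" using \<open>\<omega> \<noteq> 1\<close> \<open>\<omega> ^ p = 1\<close> by (simp add: sum_gp_strict)
  finally show ?thesis using False by simp
qed

lemma sum_chi:
  assumes "p > 0"
  shows "(\<Sum>t\<in>residue_vectors p. chi p t (z :: int ^ 'k))
          = (if \<forall>i. int p dvd z $ i then of_nat (p ^ CARD('k)) else 0)"
proof -
  have "chi p t z = (\<Prod>j\<in>UNIV. cis (2 * pi * (of_int (z $ j * t $ j) / of_nat p)))" for t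
    unfolding chi_def dot_def
    by (simp flip: cis_sum sum_distrib_left sum_divide_distrib)
  then have "(\<Sum>t\<in>residue_vectors p. chi p t z)
      = (\<Prod>j\<in>UNIV. if int p dvd z $ j then of_nat p else 0)"
    using sum_prod_residue_vectors[where g = "\<lambda>j m. cis (2 * pi * (of_int (z $ j * m) / of_nat p))"]
      sum_roots_of_unity[OF assms] by simp
  also have "\<dots> = (if \<forall>i. int p dvd z $ i then of_nat (p ^ CARD('k)) else 0)"
    using assms by (auto simp: prod_zero_iff)
  finally show ?thesis .
qed

text \<open>
  Expanding the square and summing over \<open>t\<close> first leaves only the diagonal, by orthogonality of
  characters.
\<close>

lemma plancherel:
  fixes g :: "int ^ 'k \<Rightarrow> real"
  assumes "p > 0"
  shows "(\<Sum>t\<in>residue_vectors p. (cmod (\<Sum>x\<in>residue_vectors p. of_real (g x) * chi p t x))\<^sup>2)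
          = of_nat (p ^ CARD('k)) * (\<Sum>x\<in>residue_vectors p. (g x)\<^sup>2)"
proof -
  let ?R = "residue_vectors p :: (int ^ 'k) set"
  have "complex_of_real (\<Sum>t\<in>?R. (cmod (\<Sum>x\<in>?R. of_real (g x) * chi p t x))\<^sup>2)
      = (\<Sum>t\<in>?R. \<Sum>x\<in>?R. \<Sum>y\<in>?R. of_real (g x * g y) * chi p t (x - y))"
    by (simp only: of_real_sum complex_norm_square cnj_sum sum_product)
      (simp add: chi_diff mult_ac)
  also have "\<dots> = (\<Sum>x\<in>?R. \<Sum>y\<in>?R. of_real (g x * g y) * (\<Sum>t\<in>?R. chi p t (x - y)))"
    unfolding sum_distrib_left by (subst sum.swap) (intro sum.cong refl sum.swap)
  also have "\<dots> = (\<Sum>x\<in>?R. \<Sum>y\<in>?R. if y = x then of_real (g x * g y) * of_nat (p ^ CARD('k)) else 0)"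
  proof (intro sum.cong refl)
    fix x y assume xy: "x \<in> ?R" "y \<in> ?R"
    have "(\<forall>i. int p dvd (x - y) $ i) \<longleftrightarrow> y = x"
      using residue_vectors_eqI[OF xy] by auto
    then show "of_real (g x * g y) * (\<Sum>t\<in>?R. chi p t (x - y))
      = (if y = x then complex_of_real (g x * g y) * of_nat (p ^ CARD('k)) else 0)"
      unfolding sum_chi[OF assms] by simp
  qed
  also have "\<dots> = of_real (of_nat (p ^ CARD('k)) * (\<Sum>x\<in>?R. (g x)\<^sup>2))"
    by (simp add: sum.delta' sum_distrib_left power2_eq_square mult_ac)
  finally show ?thesis by (simp only: of_real_eq_iff)
qed

text \<open>
  Subtracting the uniform law removes exactly the coefficient at \<open>t = 0\<close>. Cauchy-Schwarz and
  Plancherel do the rest; their factors \<open>p\<^sup>k\<close> cancel.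
\<close>

lemma l1_distance_uniform_le_fourier:
  fixes f :: "int ^ 'k \<Rightarrow> real"
  assumes "p > 0" "(\<Sum>x\<in>residue_vectors p. f x) = 1"
  shows "(\<Sum>x\<in>residue_vectors p. \<bar>f x - 1 / of_nat (p ^ CARD('k))\<bar>)\<^sup>2
     \<le> (\<Sum>t\<in>residue_vectors p - {0}. (cmod (\<Sum>x\<in>residue_vectors p. of_real (f x) * chi p t x))\<^sup>2)"
proof -
  let ?R = "residue_vectors p :: (int ^ 'k) set"
  define u :: real where "u = 1 / of_nat (p ^ CARD('k))"
  define g where "g x = f x - u" for x
  define G where "G t = (\<Sum>x\<in>?R. of_real (g x) * chi p t x)" for t
  have G: "G t = (\<Sum>x\<in>?R. of_real (f x) * chi p t x) - of_real u * (\<Sum>x\<in>?R. chi p t x)" for t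
    by (simp add: G_def g_def left_diff_distrib sum_subtractf sum_distrib_left)
  have "G 0 = 0"
    using assms by (simp add: G card_residue_vectors u_def flip: of_real_sum)
  have Gt: "G t = (\<Sum>x\<in>?R. of_real (f x) * chi p t x)" if "t \<in> ?R - {0}" for t
  proof -
    have "chi p t x = chi p x t" for x by (simp add: chi_def dot_def mult.commute)
    moreover have "\<not> (\<forall>i. int p dvd t $ i)"
      using residue_vectors_eqI[of t p 0] that zero_in_residue_vectors[OF assms(1)] by auto
    ultimately have "(\<Sum>x\<in>?R. chi p t x) = 0" using sum_chi[OF assms(1), of t] by (simp only: if_False)
    then show ?thesis by (simp add: G)
  qed
  have "(\<Sum>x\<in>?R. \<bar>g x\<bar>)\<^sup>2 \<le> of_nat (p ^ CARD('k)) * (\<Sum>x\<in>?R. (g x)\<^sup>2)"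
    using sum_squared_le_sum_of_squares[of "\<lambda>x. \<bar>g x\<bar>" ?R] by (simp add: card_residue_vectors mult.commute)
  also have "\<dots> = (\<Sum>t\<in>?R. (cmod (G t))\<^sup>2)"
    unfolding G_def by (rule plancherel[OF assms(1), symmetric])
  also have "\<dots> = (\<Sum>t\<in>?R - {0}. (cmod (G t))\<^sup>2)"
    using \<open>G 0 = 0\<close> zero_in_residue_vectors[OF assms(1)] by (subst sum.remove[of _ 0]) auto
  finally show ?thesis by (simp add: Gt g_def u_def)
qed

section \<open>Fourier transform of the walk\<close>

lemma norm_cis_add: "cmod (cis a + cis b) = 2 * \<bar>cos ((a - b) / 2)\<bar>"
proof -
  have "cos (a - b) = 2 * (cos ((a - b) / 2))\<^sup>2 - 1"
    by (subst cos_double_cos[symmetric]) (simp del: right_diff_distrib_numeral)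
  moreover have "(cmod (cis a + cis b))\<^sup>2
      = ((sin a)\<^sup>2 + (cos a)\<^sup>2) + ((sin b)\<^sup>2 + (cos b)\<^sup>2) + 2 * cos (a - b)"
    unfolding cmod_power2 cos_diff by (simp add: power2_eq_square algebra_simps del: sin_cos_squared_add3)
  ultimately have "(cmod (cis a + cis b))\<^sup>2 = (2 * \<bar>cos ((a - b) / 2)\<bar>)\<^sup>2"
    by (simp add: power_mult_distrib)
  then show ?thesis by (rule power2_eq_imp_eq) auto
qed

text \<open>
  After multiplication by a phase \<open>\<omega>\<close>, \<open>1 - |Z|\<close> is the expectation of the nonnegative function
  \<open>1 - Re (\<omega> \<chi>)\<close>. Keeping only the two atoms \<open>h\<close> and \<open>k\<close> shows that the coefficient falls below one
  by the amount to which \<open>\<chi>(h)\<close> and \<open>\<chi>(k)\<close> fail to point in the same direction, which is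
  measured by \<open>\<langle>h - k, t\<rangle>/p\<close> modulo one. The constant depends on \<open>\<mu>\<close>, \<open>h\<close> and \<open>k\<close> only,
  not on \<open>p\<close>.
\<close>

lemma increment_fourier_decay:
  fixes \<mu> :: "(int ^ 'k) pmf"
  assumes "h \<in> set_pmf \<mu>" "k \<in> set_pmf \<mu>"
  shows "\<exists>c>0. \<forall>p t. cmod (measure_pmf.expectation \<mu> (chi p t))
           \<le> exp (- (c * (int_dist (of_int (dot (h - k) t) / of_nat p))\<^sup>2))"
proof (cases "h = k")
  case True
  have "cmod (measure_pmf.expectation \<mu> (chi p t)) \<le> 1" for p t
    using integral_norm_bound[of "measure_pmf \<mu>" "chi p t"] by simp
  then show ?thesis using True by (intro exI[of _ 1]) (simp add: dot_def int_dist_def)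
next
  case False
  define m where "m = min (pmf \<mu> h) (pmf \<mu> k)"
  have m: "m > 0" "m \<le> pmf \<mu> h" "m \<le> pmf \<mu> k" using assms by (auto simp: m_def pmf_positive)
  have "cmod (measure_pmf.expectation \<mu> (chi p t))
           \<le> exp (- (2 * m * (int_dist (of_int (dot (h - k) t) / of_nat p))\<^sup>2))" for p t
  proof -
    define Z where "Z = measure_pmf.expectation \<mu> (chi p t)"
    have int: "integrable (measure_pmf \<mu>) (chi p t)"
      by (intro measure_pmf.integrable_const_bound[where B = 1]) auto
    define \<omega> where "\<omega> = (if Z = 0 then 1 else cnj Z / cmod Z)"
    have \<omega>: "cmod \<omega> = 1" "\<omega> * Z = cmod Z"
      by (auto simp: \<omega>_def norm_divide complex_norm_square[symmetric] power2_eq_square mult.commute[of "cnj Z"])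
    have le1: "Re (\<omega> * chi p t x) \<le> 1" for x
      using complex_Re_le_cmod[of "\<omega> * chi p t x"] \<omega>(1) by (simp add: norm_mult)
    define q where "q x = 1 - Re (\<omega> * chi p t x)" for x
    have q0: "0 \<le> q x" for x using le1 by (simp add: q_def)
    have intq: "integrable (measure_pmf \<mu>) q"
      unfolding q_def using int by (intro Bochner_Integration.integrable_diff integrable_Re integrable_mult_right) auto
    have "1 - cmod Z = measure_pmf.expectation \<mu> q"
    proof -
      have "measure_pmf.expectation \<mu> q = 1 - Re (\<omega> * Z)"
        unfolding q_def Z_def using int
        by (subst Bochner_Integration.integral_diff)
          (auto simp: integral_Re[symmetric] simp del: times_complex.simps intro!: integrable_Re)
      then show ?thesis by (simp add: \<omega>)
    qed
    also have "\<dots> \<ge> measure_pmf.expectation \<mu> (\<lambda>x. if x \<in> {h, k} then q x else 0)"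
      using q0 intq
      by (intro integral_mono) (auto intro: Bochner_Integration.integrable_bound[OF intq])
    also have "measure_pmf.expectation \<mu> (\<lambda>x. if x \<in> {h, k} then q x else 0) = pmf \<mu> h * q h + pmf \<mu> k * q k"
      using False by (subst integral_measure_pmf[where A = "{h, k}"]) (auto split: if_splits)
    also have "\<dots> \<ge> m * q h + m * q k"
      using m q0 by (intro add_mono mult_right_mono) auto
    also have "m * q h + m * q k = m * (2 - Re (\<omega> * (chi p t h + chi p t k)))"
      by (simp add: q_def algebra_simps)
    also have "\<dots> \<ge> m * (2 - cmod (chi p t h + chi p t k))"
      using m complex_Re_le_cmod[of "\<omega> * (chi p t h + chi p t k)"] \<omega>(1)
      by (intro mult_left_mono) (auto simp: norm_mult)
    also have "cmod (chi p t h + chi p t k) = 2 * \<bar>cos (pi * (of_int (dot (h - k) t) / of_nat p))\<bar>"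
      unfolding chi_def norm_cis_add by (simp add: dot_diff_left diff_divide_distrib right_diff_distrib)
    also have "m * (2 - 2 * \<bar>cos (pi * (of_int (dot (h - k) t) / of_nat p))\<bar>)
        \<ge> m * (2 * (int_dist (of_int (dot (h - k) t) / of_nat p))\<^sup>2)"
      using m abs_cos_pi_le[of "of_int (dot (h - k) t) / of_nat p"] by (intro mult_left_mono) auto
    finally have "cmod Z \<le> 1 + - (2 * m * (int_dist (of_int (dot (h - k) t) / of_nat p))\<^sup>2)"
      by (simp add: algebra_simps)
    also have "\<dots> \<le> exp (- (2 * m * (int_dist (of_int (dot (h - k) t) / of_nat p))\<^sup>2))"
      by (rule exp_ge_add_one_self)
    finally show ?thesis by (simp add: Z_def)
  qed
  then show ?thesis using m(1) by (intro exI[of _ "2 * m"]) auto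
qed

text \<open>
  Modulo \<open>p\<close>, \<open>X\<^sub>n = A\<^sup>n x\<^sub>0 + \<Sum>i<n. A^(n - 1 - i) B\<^sub>i\<close>; moving the powers of \<open>A\<close> to the other side of the
  pairing makes the character of the walk a product of functions of the separate increments.
\<close>

lemma chi_walk:
  "chi p t (walk A b x0 p n \<omega>)
     = chi p (adj_iter A n t) x0
       * (\<Prod>i<n. chi p (adj_iter A (n - 1 - i) t) (b i \<omega>))"
proof (induction n arbitrary: t)
  case 0
  then show ?case by (simp add: chi_reduce_vec)
next
  case (Suc n)
  have "chi p t (walk A b x0 p (Suc n) \<omega>) = chi p (t v* A) (walk A b x0 p n \<omega>) * chi p t (b n \<omega>)"
    by (simp add: chi_reduce_vec chi_add chi_matrix)
  also have "chi p (t v* A) (walk A b x0 p n \<omega>)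
      = chi p (adj_iter A (Suc n) t) x0 * (\<Prod>i<n. chi p (adj_iter A (Suc n - 1 - i) t) (b i \<omega>))"
  proof -
    have "adj_iter A (n - 1 - i) (t v* A) = adj_iter A (Suc n - 1 - i) t" if "i < n" for i
    proof -
      have "Suc n - 1 - i = Suc (n - 1 - i)" using that by simp
      then show ?thesis by (simp only: adj_iter_Suc_right)
    qed
    then show ?thesis
      unfolding Suc.IH by (simp add: adj_iter_Suc_right)
  qed
  finally show ?case by (simp add: mult.assoc)
qed

lemma walk_measurable:
  assumes "\<And>i. b i \<in> measurable M (count_space UNIV)"
  shows "walk A b x0 p n \<in> measurable M (count_space UNIV)"
proof (induction n)
  case (Suc n)
  have eq: "walk A b x0 p (Suc n)
    = (\<lambda>xy. reduce_vec p (A *v fst xy + snd xy)) \<circ> (\<lambda>\<omega>. (walk A b x0 p n \<omega>, b n \<omega>))"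
    by (simp add: fun_eq_iff)
  have "(\<lambda>\<omega>. (walk A b x0 p n \<omega>, b n \<omega>)) \<in> measurable M (count_space UNIV \<Otimes>\<^sub>M count_space UNIV)"
    using Suc assms by (intro measurable_Pair) auto
  then have "(\<lambda>\<omega>. (walk A b x0 p n \<omega>, b n \<omega>)) \<in> measurable M (count_space UNIV)"
    by (simp add: pair_measure_countable)
  then show ?case unfolding eq by (rule measurable_comp) simp
qed simp

lemma (in prob_space) expectation_finite_range:
  fixes f :: "'b \<Rightarrow> complex"
  assumes X: "X \<in> measurable M (count_space UNIV)" and R: "finite R" "\<And>\<omega>. X \<omega> \<in> R"
  shows "(\<Sum>x\<in>R. of_real (measure (distr M (count_space UNIV) X) {x}) * f x) = expectation (\<lambda>\<omega>. f (X \<omega>))"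
proof -
  have "f (X \<omega>) = (\<Sum>x\<in>R. indicator (X -` {x} \<inter> space M) \<omega> *\<^sub>R f x)" if "\<omega> \<in> space M" for \<omega>
    using R that by (simp add: indicator_def of_bool_def if_distrib[of "\<lambda>c. c *\<^sub>R _"] sum.delta cong: if_cong)
  then have "expectation (\<lambda>\<omega>. f (X \<omega>)) = expectation (\<lambda>\<omega>. \<Sum>x\<in>R. indicator (X -` {x} \<inter> space M) \<omega> *\<^sub>R f x)"
    by (intro Bochner_Integration.integral_cong) auto
  also have "\<dots> = (\<Sum>x\<in>R. expectation (\<lambda>\<omega>. indicator (X -` {x} \<inter> space M) \<omega> *\<^sub>R f x))"
    using X by (intro Bochner_Integration.integral_sum integrable_scaleR_left)
      (auto intro!: integrable_real_indicator measurable_sets simp: less_top[symmetric])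
  also have "\<dots> = (\<Sum>x\<in>R. of_real (measure (distr M (count_space UNIV) X) {x}) * f x)"
    using X by (intro sum.cong refl) (simp add: measure_distr scaleR_conv_of_real)
  finally show ?thesis by simp
qed

lemma (in prob_space) fourier_walk_law:
  fixes A :: "int ^ 'k ^ 'k" and b :: "nat \<Rightarrow> 'a \<Rightarrow> int ^ 'k"
  assumes indep: "indep_vars (\<lambda>_. count_space UNIV) b UNIV"
    and law: "\<And>n. distr M (count_space UNIV) (b n) = measure_pmf \<mu>"
    and p: "p > 0"
  shows "cmod (\<Sum>x\<in>residue_vectors p. of_real (measure (walk_law M A b x0 p n) {x}) * chi p t x)
     = (\<Prod>i<n. cmod (measure_pmf.expectation \<mu> (chi p (adj_iter A i t))))"
proof -
  have b: "b i \<in> measurable M (count_space UNIV)" for i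
    using indep by (auto simp: indep_vars_def)
  have W: "walk A b x0 p n \<in> measurable M (count_space UNIV)"
    by (rule walk_measurable) (rule b)
  have R: "walk A b x0 p n \<omega> \<in> residue_vectors p" for \<omega>
    using p by (cases n) auto
  have "(\<Sum>x\<in>residue_vectors p. of_real (measure (walk_law M A b x0 p n) {x}) * chi p t x)
      = expectation (\<lambda>\<omega>. chi p t (walk A b x0 p n \<omega>))"
    unfolding walk_law_def by (rule expectation_finite_range[OF W]) (simp_all add: R)
  also have "\<dots> = chi p (adj_iter A n t) x0 * expectation (\<lambda>\<omega>. \<Prod>i<n. chi p (adj_iter A (n - 1 - i) t) (b i \<omega>))"
    by (simp add: chi_walk)
  also have "expectation (\<lambda>\<omega>. \<Prod>i<n. chi p (adj_iter A (n - 1 - i) t) (b i \<omega>))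
      = (\<Prod>i<n. expectation (\<lambda>\<omega>. chi p (adj_iter A (n - 1 - i) t) (b i \<omega>)))"
  proof (rule indep_vars_lebesgue_integral)
    have "indep_vars (\<lambda>_. count_space UNIV) b {..<n}"
      using indep by (rule indep_vars_subset) simp
    then show "indep_vars (\<lambda>_. borel) (\<lambda>i \<omega>. chi p (adj_iter A (n - 1 - i) t) (b i \<omega>)) {..<n}"
      by (rule indep_vars_compose2) simp
    show "integrable M (\<lambda>\<omega>. chi p (adj_iter A (n - 1 - i) t) (b i \<omega>))" if "i \<in> {..<n}" for i
      using measurable_compose[OF b, of "chi p (adj_iter A (n - 1 - i) t)" borel i]
      by (intro integrable_const_bound[where B = 1]) auto
  qed simp
  also have "\<dots> = (\<Prod>i<n. measure_pmf.expectation \<mu> (chi p (adj_iter A (n - 1 - i) t)))"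
    by (intro prod.cong refl, subst law[symmetric], subst integral_distr[OF b]) auto
  finally have "cmod (\<Sum>x\<in>residue_vectors p. of_real (measure (walk_law M A b x0 p n) {x}) * chi p t x)
      = (\<Prod>i<n. cmod (measure_pmf.expectation \<mu> (chi p (adj_iter A (n - 1 - i) t))))"
    by (simp add: norm_mult prod_norm)
  also have "\<dots> = (\<Prod>i<n. cmod (measure_pmf.expectation \<mu> (chi p (adj_iter A i t))))"
    using prod.nat_diff_reindex[of "\<lambda>i. cmod (measure_pmf.expectation \<mu> (chi p (adj_iter A i t)))" n]
    by simp
  finally show ?thesis .
qed

section \<open>The minimum polynomial and its unit root\<close>

lemma dot_sum_left: "dot (\<Sum>i\<in>I. f i) t = (\<Sum>i\<in>I. dot (f i) t)"
  by (simp add: dot_def sum_component sum_distrib_right sum.swap[of _ I UNIV])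

lemma matrix_vector_mult_sum_left: "(\<Sum>i\<in>I. f i) *v y = (\<Sum>i\<in>I. f i *v (y :: 'a::comm_ring_1 ^ 'k))"
  by (induction I rule: infinite_finite_induct) (simp_all add: matrix_vector_mult_add_rdistrib)

lemma dot_mat_mult: "dot ((mat c ** P) *v y) t = c * dot (P *v y) t"
proof -
  have "mat c *v z = c *s z" for z :: "'a ^ 'b"
    by (simp add: vec_eq_iff matrix_vector_mult_def mat_def if_distrib[of "\<lambda>x. x * _"] cong: if_cong)
  then have "(mat c ** P) *v y = c *s (P *v y)"
    by (simp flip: matrix_vector_mul_assoc)
  then show ?thesis by (simp add: dot_def sum_distrib_left mult.assoc)
qed

text \<open>
  Pairing \<open>q(M) M\<^sup>i y = 0\<close> with \<open>t\<close> turns the annihilating polynomial into a scalar linear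
  recurrence.
\<close>

lemma shift_eval_adj_iter:
  assumes "poly_mat q M = 0"
  shows "shift_eval q (\<lambda>i. dot y (adj_iter M i t)) i = 0"
proof -
  have "shift_eval q (\<lambda>i. dot y (adj_iter M i t)) i
      = (\<Sum>j\<le>degree q. coeff q j * dot (mat_power M j *v y) (adj_iter M i t))"
    by (simp add: shift_eval_def dot_mat_power flip: adj_iter_add) (simp add: add.commute)
  also have "\<dots> = dot (poly_mat q M *v y) (adj_iter M i t)"
    by (simp add: poly_mat_def matrix_vector_mult_sum_left dot_sum_left dot_mat_mult)
  finally show ?thesis by (simp add: assms dot_def)
qed

lemma rat_vec_vector_matrix: "rat_vec (t v* A) = rat_vec t v* rat_mat A"
  by (simp add: rat_vec_def rat_mat_def vector_matrix_mult_def vec_eq_iff)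

lemma rat_vec_adj_iter: "rat_vec (adj_iter A i t) = adj_iter (rat_mat A) i (rat_vec t)"
  by (induction i) (simp_all add: adj_iter_Suc rat_vec_vector_matrix)

lemma dot_rat_vec: "dot (rat_vec x) (rat_vec y) = of_int (dot x y)"
  by (simp add: dot_def rat_vec_def)

lemma map_poly_of_rat_mult:
  "map_poly of_rat (P * Q) = (map_poly of_rat P * map_poly of_rat Q :: complex poly)"
  by (rule poly_eqI) (simp add: coeff_map_poly coeff_mult of_rat_sum of_rat_mult)

lemma poly_map_poly_of_rat: "poly (map_poly of_rat P) (of_rat x) = (of_rat (poly P x) :: complex)"
  by (induction P) (simp_all add: map_poly_pCons of_rat_add of_rat_mult)

lemma shift_eval_of_rat:
  "shift_eval (map_poly of_rat P) (\<lambda>i. of_rat (z i)) i = (of_rat (shift_eval P z i) :: complex)"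
  by (induction P arbitrary: i) (simp_all add: map_poly_pCons of_rat_add of_rat_mult)

lemma ex_common_denominator:
  "\<exists>D::int. D > 0 \<and> (\<forall>j. of_int D * coeff (P :: rat poly) j \<in> \<int>)"
proof (induction P)
  case 0
  then show ?case by (intro exI[of _ 1]) simp
next
  case (pCons a P)
  then obtain D :: int where D: "D > 0" "\<And>j. of_int D * coeff P j \<in> \<int>" by blast
  obtain m n where mn: "quotient_of a = (m, n)" by fastforce
  then have n: "n > 0" and a: "a = of_int m / of_int n"
    by (auto simp: quotient_of_denom_pos quotient_of_div)
  have "of_int (D * n) * coeff (pCons a P) j \<in> \<int>" for j
  proof (cases j)
    case 0
    have "of_int (D * n) * a = of_int (D * m)" using n by (simp add: a)
    then show ?thesis using 0 by (metis Ints_of_int coeff_pCons_0)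
  next
    case (Suc l)
    have "of_int n * (of_int D * coeff P l) \<in> \<int>" by (intro Ints_mult Ints_of_int D)
    then show ?thesis using Suc by (simp add: mult_ac)
  qed
  then show ?case using D(1) n by (intro exI[of _ "D * n"]) auto
qed

text \<open>
  The polynomial is rational, so the conjugate of \<open>ev 1\<close> is again one of the listed roots, of
  modulus one; only \<open>ev 1\<close> itself qualifies. A real number of modulus one is \<open>\<plusminus>1\<close>, so the
  factor splits off over the rationals.
\<close>

lemma unit_root_splits_off:
  fixes q :: "rat poly" and ev :: "nat \<Rightarrow> complex"
  assumes q: "map_poly of_rat q = (\<Prod>i=1..d. [:- ev i, 1:])" and d: "d \<ge> 1"
    and unit: "cmod (ev 1) = 1" and expanding: "\<And>i. i \<in> {2..d} \<Longrightarrow> cmod (ev i) > 1"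
  obtains \<epsilon> :: int and r :: "rat poly" where "\<epsilon> = 1 \<or> \<epsilon> = - 1"
    "map_poly of_rat r = (\<Prod>i=2..d. [:- ev i, 1:])" "q = [:- of_int \<epsilon>, 1:] * r"
proof -
  have prod: "(\<Prod>i=1..d. [:- ev i, 1:]) = [:- ev 1, 1:] * (\<Prod>i=2..d. [:- ev i, 1:])"
    using d by (simp add: prod.atLeast_Suc_atMost numeral_2_eq_2)
  have "poly (map_poly of_rat q) (ev 1) = 0"
    unfolding q prod by simp
  moreover have "coeff (map_poly of_rat q :: complex poly) i \<in> \<real>" for i
  proof -
    have "(of_rat x :: complex) = of_real (of_rat x)" for x
      by (cases x) (simp add: of_rat_rat)
    then show ?thesis by (simp add: coeff_map_poly)
  qed
  ultimately have "poly (map_poly of_rat q) (cnj (ev 1)) = 0"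
    by (subst real_poly_cnj_root_iff) auto
  then obtain i where i: "i \<in> {1..d}" "cnj (ev 1) = ev i"
    unfolding q by (auto simp: poly_prod)
  have "i = 1"
  proof (rule ccontr)
    assume "i \<noteq> 1"
    with i(1) expanding[of i] have "cmod (ev i) > 1" by auto
    then show False using i(2) unit by (metis complex_mod_cnj less_irrefl)
  qed
  then have "Im (ev 1) = 0" using i(2) \<open>i = 1\<close> by (simp add: complex_eq_iff)
  then have "ev 1 = of_real (Re (ev 1))" by (simp add: complex_eq_iff)
  moreover from this have "\<bar>Re (ev 1)\<bar> = 1" using unit by (metis norm_of_real)
  ultimately obtain \<epsilon> :: int where \<epsilon>: "\<epsilon> = 1 \<or> \<epsilon> = - 1" "ev 1 = of_int \<epsilon>"
    by (cases "Re (ev 1) = 1") (force simp: abs_if split: if_splits)+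
  have "of_rat (poly q (of_int \<epsilon>)) = (0 :: complex)"
    using \<open>poly (map_poly of_rat q) (ev 1) = 0\<close> unfolding \<epsilon>(2)
    by (metis poly_map_poly_of_rat of_rat_of_int_eq)
  then obtain r where r: "q = [:- of_int \<epsilon>, 1:] * r"
    by (auto simp: poly_eq_0_iff_dvd)
  have "[:- ev 1, 1:] * map_poly of_rat r = [:- ev 1, 1:] * (\<Prod>i=2..d. [:- ev i, 1:])"
    using q unfolding r map_poly_of_rat_mult prod by (simp add: map_poly_pCons \<epsilon>(2)[unfolded One_nat_def] of_rat_minus)
  then have "map_poly of_rat r = (\<Prod>i=2..d. [:- ev i, 1:])"
    by (subst (asm) mult_left_cancel) auto
  with \<epsilon> r that show thesis by blast
qed

section \<open>Energy of a character\<close>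

text \<open>
  The exponent governing the Fourier coefficient at \<open>t\<close>: how far the orbit of \<open>t/p\<close> stays from
  pairing integrally with the columns of \<open>B\<close> during \<open>n\<close> steps.
\<close>

definition energy :: "int ^ 'k ^ 'k \<Rightarrow> int ^ 'k ^ 'k \<Rightarrow> nat \<Rightarrow> nat \<Rightarrow> int ^ 'k \<Rightarrow> real" where
  "energy A B p n t =
     (\<Sum>i<n. \<Sum>j\<in>UNIV. (int_dist (of_int (dot (column j B) (adj_iter A i t)) / of_nat p))\<^sup>2)"

text \<open>
  Each factor of the Fourier coefficient is at most \<open>exp (- c z\<^sup>2)\<close>, where \<open>z\<close> is the
  distance to the integers attached to any single difference \<open>x\<^sub>j\<close>; the geometric mean over the \<open>k\<close> columns
  replaces this by the sum over all of them. Writing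
  \<open>y\<^sub>j = A\<^sup>m x\<^sub>j\<close> with \<open>m < d\<close>, the pairing of \<open>y\<^sub>j\<close> at time \<open>i\<close> is that of \<open>x\<^sub>j\<close> at time \<open>i + m\<close>,
  whence the loss of \<open>d\<close> time steps.
\<close>

lemma fourier_decay:
  fixes A B :: "int ^ 'k ^ 'k" and \<mu> :: "(int ^ 'k) pmf"
  assumes "\<forall>j. column j B \<in> iterated_differences A d \<mu>"
  shows "\<exists>\<beta>>0. \<forall>p n t. (\<Prod>i<n. cmod (measure_pmf.expectation \<mu> (chi p (adj_iter A i t))))
           \<le> exp (- (\<beta> * energy A B p (n - d) t))"
proof -
  have "\<forall>j. \<exists>m x. column j B = mat_power A m *v x \<and> m < d \<and> x \<in> support_differences \<mu>"
    using assms by (fastforce simp: iterated_differences_def)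
  then obtain m x where mx: "\<And>j. column j B = mat_power A (m j) *v x j" "\<And>j. m j < d"
      "\<And>j. x j \<in> support_differences \<mu>" by metis
  have "\<exists>c>0. \<forall>p t. cmod (measure_pmf.expectation \<mu> (chi p t))
           \<le> exp (- (c * (int_dist (of_int (dot (x j) t) / of_nat p))\<^sup>2))" for j
    using mx(3)[of j] increment_fourier_decay[of _ \<mu>] by (force simp: support_differences_def)
  then obtain c where c: "\<And>j. c j > 0" "\<And>j p t. cmod (measure_pmf.expectation \<mu> (chi p t))
           \<le> exp (- (c j * (int_dist (of_int (dot (x j) t) / of_nat p))\<^sup>2))" by metis
  define c0 where "c0 = Min (range c)"
  have c0: "c0 > 0" "\<And>j. c0 \<le> c j" using c(1) by (auto simp: c0_def)
  define \<beta> where "\<beta> = c0 / real CARD('k)"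
  have \<beta>: "\<beta> > 0" using c0(1) by (simp add: \<beta>_def)
  define g where "g p t j i = (int_dist (of_int (dot (x j) (adj_iter A i t)) / of_nat p))\<^sup>2"
    for p :: nat and t j i
  have step: "cmod (measure_pmf.expectation \<mu> (chi p (adj_iter A i t))) \<le> exp (- (\<beta> * (\<Sum>j\<in>UNIV. g p t j i)))"
    for p t i
  proof -
    let ?u = "cmod (measure_pmf.expectation \<mu> (chi p (adj_iter A i t)))"
    have "?u ^ CARD('k) = (\<Prod>j\<in>(UNIV :: 'k set). ?u)" by simp
    also have "\<dots> \<le> (\<Prod>j\<in>UNIV. exp (- (c0 * g p t j i)))"
    proof (intro prod_mono conjI)
      fix j
      have "?u \<le> exp (- (c j * g p t j i))" unfolding g_def by (rule c(2))
      also have "\<dots> \<le> exp (- (c0 * g p t j i))"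
        using c0(2)[of j] by (auto simp: g_def intro!: mult_right_mono)
      finally show "?u \<le> exp (- (c0 * g p t j i))" .
    qed simp
    also have "\<dots> = exp (- (\<beta> * (\<Sum>j\<in>UNIV. g p t j i))) ^ CARD('k)"
      by (simp add: \<beta>_def exp_sum[symmetric] sum_negf sum_distrib_left flip: exp_of_nat_mult)
    finally show ?thesis
      by (rule power_le_imp_le_base[where n = "CARD('k) - 1", unfolded Suc_diff_1[OF zero_less_card_finite]]) simp
  qed
  have "(\<Prod>i<n. cmod (measure_pmf.expectation \<mu> (chi p (adj_iter A i t))))
           \<le> exp (- (\<beta> * energy A B p (n - d) t))" for p n t
  proof -
    have "(\<Prod>i<n. cmod (measure_pmf.expectation \<mu> (chi p (adj_iter A i t))))
        \<le> (\<Prod>i<n. exp (- (\<beta> * (\<Sum>j\<in>UNIV. g p t j i))))"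
      by (intro prod_mono conjI step) simp
    also have "\<dots> = exp (- (\<beta> * (\<Sum>i<n. \<Sum>j\<in>UNIV. g p t j i)))"
      by (simp add: exp_sum[symmetric] sum_negf sum_distrib_left)
    also have "\<dots> \<le> exp (- (\<beta> * energy A B p (n - d) t))"
    proof -
      have "energy A B p (n - d) t = (\<Sum>i<n - d. \<Sum>j\<in>UNIV. g p t j (m j + i))"
        unfolding energy_def g_def mx(1) dot_mat_power by (simp add: adj_iter_add)
      also have "\<dots> = (\<Sum>j\<in>UNIV. \<Sum>i<n - d. g p t j (m j + i))" by (rule sum.swap)
      also have "\<dots> \<le> (\<Sum>j\<in>UNIV. \<Sum>i<n. g p t j i)"
      proof (rule sum_mono)
        fix j
        have "(\<Sum>i<n - d. g p t j (m j + i)) = (\<Sum>i\<in>(+) (m j) ` {..<n - d}. g p t j i)"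
          by (simp add: sum.reindex)
        also have "\<dots> \<le> (\<Sum>i<n. g p t j i)"
          using mx(2)[of j] by (intro sum_mono2) (auto simp: g_def)
        finally show "(\<Sum>i<n - d. g p t j (m j + i)) \<le> (\<Sum>i<n. g p t j i)" .
      qed
      also have "\<dots> = (\<Sum>i<n. \<Sum>j\<in>UNIV. g p t j i)" by (rule sum.swap)
      finally show ?thesis using \<beta> by simp
    qed
    finally show ?thesis .
  qed
  with \<beta> show ?thesis by blast
qed

lemma dvd_vec_if_dvd_vector_matrix:
  fixes M :: "int ^ 'k ^ 'k"
  assumes "coprime (det M) q" "\<And>i. q dvd (x v* M) $ i"
  shows "q dvd x $ k"
  by (rule dvd_vec_if_dvd_matrix_vector[of "transpose M"]) (simp_all add: assms det_transpose)

lemma adj_iter_not_dvd: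
  fixes A :: "int ^ 'k ^ 'k"
  assumes "coprime (det A) q" "\<not> (\<forall>i. q dvd t $ i)"
  shows "\<not> (\<forall>i. q dvd adj_iter A m t $ i)"
  using assms by (induction m) (auto simp: adj_iter_Suc dest: dvd_vec_if_dvd_vector_matrix)

lemma energy_eigenvector:
  fixes A B :: "int ^ 'k ^ 'k"
  assumes \<epsilon>: "\<epsilon> = 1 \<or> \<epsilon> = - 1" and t: "\<And>i. int p dvd (t v* A - \<epsilon> *s t) $ i"
  shows "energy A B p n t = n * (\<Sum>j\<in>UNIV. (int_dist (of_int (dot (column j B) t) / of_nat p))\<^sup>2)"
proof -
  have dvd: "int p dvd (adj_iter A m t - \<epsilon> ^ m *s t) $ i" for m i
  proof (induction m arbitrary: i)
    case (Suc m)
    have eq: "adj_iter A (Suc m) t - \<epsilon> ^ Suc m *s t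
        = (adj_iter A m t - \<epsilon> ^ m *s t) v* A + \<epsilon> ^ m *s (t v* A - \<epsilon> *s t)"
      by (simp add: adj_iter_Suc vector_matrix_diff vector_matrix_scale)
        (simp add: vec_eq_iff algebra_simps)
    have "int p dvd ((adj_iter A m t - \<epsilon> ^ m *s t) v* A) $ i"
      unfolding vector_matrix_nth by (rule dvd_dot_right) (rule Suc.IH)
    then show ?case
      unfolding eq vector_add_component vector_smult_component by (intro dvd_add dvd_mult t)
  qed simp
  have "int_dist (of_int (dot y (adj_iter A m t)) / of_nat p) = int_dist (of_int (dot y t) / of_nat p)" for y m
  proof -
    have "int p dvd dot y (adj_iter A m t - \<epsilon> ^ m *s t)" by (rule dvd_dot_right) (rule dvd)
    then have "int_dist (of_int (dot y (adj_iter A m t)) / of_nat p)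
        = int_dist (of_int (\<epsilon> ^ m * dot y t) / of_nat p)"
      by (intro int_dist_cong_mod) (simp add: dot_diff_right dot_scale_right)
    moreover have "\<epsilon> ^ m = 1 \<or> \<epsilon> ^ m = - 1" using \<epsilon> by (cases "even m") auto
    ultimately show ?thesis by (auto simp del: of_int_mult of_int_power)
  qed
  then show ?thesis by (simp add: energy_def)
qed

lemma sum_lessThan_ge_blocks:
  fixes f :: "nat \<Rightarrow> real"
  assumes "\<And>i. 0 \<le> f i" "\<And>i. c \<le> sum f {i..<i + w}"
  shows "real (n div w) * c \<le> sum f {..<n}"
proof -
  have "real (n div w) * c \<le> (\<Sum>m<n div w. sum f {m * w..<m * w + w})"
    using assms(2) sum_bounded_below[of "{..<n div w}" c "\<lambda>m. sum f {m * w..<m * w + w}"] by simp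
  also have "\<dots> = sum f {..<n div w * w}" by (rule sum.nat_group)
  also have "\<dots> \<le> sum f {..<n}"
    using assms(1) by (intro sum_mono2) (auto intro: less_le_trans)
  finally show ?thesis .
qed

text \<open>
  Put \<open>s = S t - \<epsilon> t\<close>. At any starting time some column pairs with \<open>S\<^sup>i s\<close> to a nonmultiple of
  \<open>p\<close>, because both determinants are units modulo \<open>p\<close>; within the next \<open>K p\<close> steps the expanding
  recurrence drives that pairing, divided by \<open>p\<close>, to distance \<open>\<delta>\<close> from the integers. As it is
  the difference, up to sign, of two consecutive pairings with the orbit of \<open>t\<close>, one of these has
  distance at least \<open>\<delta>/2\<close>. The extra \<open>2\<close> in the block length makes room for both.
\<close>

lemma energy_expanding:
  fixes A B :: "int ^ 'k ^ 'k" and q r :: "rat poly" and ev :: "'i \<Rightarrow> complex"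
  assumes q: "poly_mat q (rat_mat A) = 0" "q = [:- of_int \<epsilon>, 1:] * r"
    and \<epsilon>: "\<epsilon> = 1 \<or> \<epsilon> = - 1"
    and r: "map_poly of_rat r = (\<Prod>i\<in>I. [:- ev i, 1:])"
    and I: "finite I" "\<And>i. i \<in> I \<Longrightarrow> cmod (ev i) > 1"
  shows "\<exists>\<gamma>>0. \<exists>K. \<forall>p>0. coprime (det A) (int p) \<longrightarrow> coprime (det B) (int p) \<longrightarrow>
           (\<forall>n t. \<not> (\<forall>i. int p dvd (t v* A - \<epsilon> *s t) $ i) \<longrightarrow>
              \<gamma> * real (n div (K * p + 2)) \<le> energy A B p n t)"
proof -
  obtain D :: int where D: "D > 0" "\<And>j. of_int D * coeff r j \<in> \<int>"
    using ex_common_denominator by blast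
  have D': "of_int D * coeff (\<Prod>i\<in>I. [:- ev i, 1:]) j \<in> \<int>" for j
  proof -
    obtain z where "of_int D * coeff r j = of_int z" using D(2) by (auto elim: Ints_cases)
    then have "of_rat (of_int D * coeff r j) = (of_rat (of_int z) :: complex)" by simp
    then show ?thesis by (simp add: coeff_map_poly of_rat_mult flip: r)
  qed
  obtain \<delta> K where \<delta>: "\<delta> > 0" and esc: "\<And>p a i. p > 0 \<Longrightarrow>
      (\<And>i. shift_eval (map_poly of_rat r) (\<lambda>i. complex_of_int (a i)) i = 0) \<Longrightarrow> \<not> int p dvd a i \<Longrightarrow>
       \<exists>j \<le> K * p. \<delta> \<le> int_dist (of_int (a (i + j)) / of_nat p)"
    using expanding_recurrence_mod_escapes[of I ev D, OF I D(1) D', folded r] by metis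
  define \<gamma> where "\<gamma> = (\<delta> / 2)\<^sup>2"
  have "\<gamma> * real (n div (K * p + 2)) \<le> energy A B p n t"
    if p: "p > 0" "coprime (det A) (int p)" "coprime (det B) (int p)"
      and t: "\<not> (\<forall>i. int p dvd (t v* A - \<epsilon> *s t) $ i)" for p n t
  proof -
    define s where "s = t v* A - \<epsilon> *s t"
    define b where "b j i = dot (column j B) (adj_iter A i t)" for j i
    define f where "f i = (\<Sum>j\<in>UNIV. (int_dist (of_int (b j i) / of_nat p))\<^sup>2)" for i
    have adj_s: "adj_iter A i s = adj_iter A (Suc i) t - \<epsilon> *s adj_iter A i t" for i
      unfolding s_def adj_iter_diff_scale adj_iter_Suc_right ..
    have dot_s: "dot (column j B) (adj_iter A i s) = b j (Suc i) - \<epsilon> * b j i" for i j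
      unfolding adj_s b_def by (simp add: dot_diff_right dot_scale_right)
    have rec: "shift_eval (map_poly of_rat r) (\<lambda>i. complex_of_int (dot (column j B) (adj_iter A i s))) i = 0" for i j
    proof -
      define z where "z i = dot (rat_vec (column j B)) (adj_iter (rat_mat A) i (rat_vec t))" for i
      have z: "z i = of_int (b j i)" for i
        by (simp add: z_def b_def dot_rat_vec flip: rat_vec_adj_iter)
      have "0 = shift_eval q z i"
        unfolding z_def using shift_eval_adj_iter[OF q(1)] by simp
      also have "\<dots> = shift_eval r (shift_eval [:- of_int \<epsilon>, 1:] z) i"
        by (simp only: q(2) mult.commute[of _ r] shift_eval_mult)
      also have "shift_eval [:- of_int \<epsilon>, 1:] z = (\<lambda>i. of_int (dot (column j B) (adj_iter A i s)))"
        by (rule ext) (simp add: z dot_s)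
      finally show ?thesis
        using shift_eval_of_rat[of r "\<lambda>i. of_int (dot (column j B) (adj_iter A i s))" i] by simp
    qed
    have f0: "0 \<le> f i" for i by (simp add: f_def sum_nonneg)
    have block: "\<gamma> \<le> sum f {i0..<i0 + (K * p + 2)}" for i0
    proof -
      have "\<not> (\<forall>i. int p dvd adj_iter A i0 s $ i)"
        using adj_iter_not_dvd[OF p(2) t] by (simp add: s_def)
      then obtain j where "\<not> int p dvd (adj_iter A i0 s v* B) $ j"
        using dvd_vec_if_dvd_vector_matrix[OF p(3)] by blast
      then have "\<not> int p dvd dot (column j B) (adj_iter A i0 s)" by (simp add: vector_matrix_nth)
      from esc[OF p(1) rec this] obtain l where l: "l \<le> K * p"
        "\<delta> \<le> int_dist (of_int (dot (column j B) (adj_iter A (i0 + l) s)) / of_nat p)" by blast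
      note l(2)
      also have "int_dist (of_int (dot (column j B) (adj_iter A (i0 + l) s)) / of_nat p)
          \<le> int_dist (of_int (b j (Suc (i0 + l))) / of_nat p) + int_dist (of_int (\<epsilon> * b j (i0 + l)) / of_nat p)"
        unfolding dot_s of_int_diff diff_divide_distrib by (rule int_dist_diff_le)
      also have "int_dist (of_int (\<epsilon> * b j (i0 + l)) / of_nat p) = int_dist (of_int (b j (i0 + l)) / of_nat p)"
        using \<epsilon> by auto
      finally have "\<delta> / 2 \<le> int_dist (of_int (b j (Suc (i0 + l))) / of_nat p)
          \<or> \<delta> / 2 \<le> int_dist (of_int (b j (i0 + l)) / of_nat p)" by linarith
      then obtain i where i: "i = i0 + l \<or> i = Suc (i0 + l)" "\<delta> / 2 \<le> int_dist (of_int (b j i) / of_nat p)"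
        by blast
      have "\<gamma> \<le> (int_dist (of_int (b j i) / of_nat p))\<^sup>2"
        unfolding \<gamma>_def using i(2) \<delta> by (intro power_mono) auto
      also have "\<dots> \<le> f i"
        unfolding f_def by (rule member_le_sum) auto
      also have "\<dots> \<le> sum f {i0..<i0 + (K * p + 2)}"
        using i(1) l(1) f0 by (intro member_le_sum) auto
      finally show ?thesis .
    qed
    have "real (n div (K * p + 2)) * \<gamma> \<le> sum f {..<n}"
      by (rule sum_lessThan_ge_blocks[OF f0 block])
    then show ?thesis by (simp add: energy_def f_def b_def mult.commute)
  qed
  moreover have "\<gamma> > 0" using \<delta> by (simp add: \<gamma>_def)
  ultimately show ?thesis by blast
qed

section \<open>Gaussian sums over residue vectors\<close>

text \<open>
  With \<open>x = exp (- s/p\<^sup>2) \<le> 1/2\<close>, the term at \<open>m\<close> is at most \<open>x\<close> to the power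
  \<open>min (m, p - m)\<close>, since squares of natural numbers dominate the numbers themselves. Two geometric
  series remain.
\<close>

lemma gaussian_sum_1d:
  assumes "p > 0" "s \<ge> (real p)\<^sup>2"
  shows "(\<Sum>m\<in>{0..<int p}. exp (- (s * (int_dist (of_int m / of_nat p))\<^sup>2))) \<le> 4"
proof -
  define x where "x = exp (- (s / (real p)\<^sup>2))"
  have "exp (- 1) \<le> (1 / 2 :: real)"
    using exp_ge_add_one_self[of 1] by (simp add: exp_minus field_simps)
  moreover have "x \<le> exp (- 1)" using assms by (simp add: x_def field_simps)
  ultimately have "x \<le> 1 / 2" by linarith
  moreover have "0 < x" by (simp add: x_def)
  ultimately have x: "0 < x" "x \<le> 1 / 2" by simp_all
  have geo: "(\<Sum>m<p. x ^ m) \<le> 2"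
  proof -
    have "(\<Sum>m<p. x ^ m) = (1 - x ^ p) / (1 - x)" using x by (simp add: sum_gp_strict)
    also have "\<dots> \<le> 1 / (1 - x)" using x by (intro divide_right_mono) auto
    also have "\<dots> \<le> 2" using x by (simp add: field_simps)
    finally show ?thesis .
  qed
  have bound: "exp (- (s * (int_dist (real m / real p))\<^sup>2)) \<le> x ^ m + x ^ (p - m)" if "m < p" for m
  proof -
    define k where "k = min m (p - m)"
    have "real k / real p \<le> int_dist (real m / real p)"
    proof (cases "round (real m / real p) \<le> 0")
      case True
      then have "real m / real p \<le> int_dist (real m / real p)"
        unfolding int_dist_def by (intro order_trans[OF _ abs_ge_self]) simp
      moreover have "real k / real p \<le> real m / real p"
        by (intro divide_right_mono) (auto simp: k_def)
      ultimately show ?thesis by simp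
    next
      case False
      then have "1 \<le> real_of_int (round (real m / real p))" by linarith
      then have "1 - real m / real p \<le> int_dist (real m / real p)"
        unfolding int_dist_def by linarith
      moreover have "real k / real p \<le> 1 - real m / real p"
        using that assms(1) by (auto simp: k_def field_simps of_nat_diff)
      ultimately show ?thesis by simp
    qed
    then have "(real k / real p)\<^sup>2 \<le> (int_dist (real m / real p))\<^sup>2"
      by (intro power_mono) auto
    moreover have "real k / (real p)\<^sup>2 \<le> (real k / real p)\<^sup>2"
    proof -
      have "k \<le> k\<^sup>2" by (simp add: power2_eq_square)
      then have "real k \<le> (real k)\<^sup>2" by (metis of_nat_mono of_nat_power)
      then show ?thesis by (simp add: power_divide divide_right_mono)
    qed
    ultimately have "real k / (real p)\<^sup>2 \<le> (int_dist (real m / real p))\<^sup>2" by linarith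
    moreover have "0 \<le> s" using assms(2) by (meson order_trans zero_le_power2)
    ultimately have "s * (real k / (real p)\<^sup>2) \<le> s * (int_dist (real m / real p))\<^sup>2"
      by (rule mult_left_mono)
    then have "exp (- (s * (int_dist (real m / real p))\<^sup>2)) \<le> exp (real k * - (s / (real p)\<^sup>2))"
      by (simp add: mult.commute)
    also have "\<dots> = x ^ k" unfolding x_def by (rule exp_of_nat_mult)
    also have "\<dots> \<le> x ^ m + x ^ (p - m)" using x by (auto simp: k_def min_def)
    finally show ?thesis .
  qed
  have "(\<Sum>m\<in>{0..<int p}. exp (- (s * (int_dist (of_int m / of_nat p))\<^sup>2)))
      = (\<Sum>m<p. exp (- (s * (int_dist (real m / real p))\<^sup>2)))"
    by (rule sum.reindex_bij_witness[where i = int and j = nat]) auto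
  also have "\<dots> \<le> (\<Sum>m<p. x ^ m) + (\<Sum>m<p. x ^ (p - m))"
    unfolding sum.distrib[symmetric] by (intro sum_mono bound) simp
  also have "(\<Sum>m<p. x ^ (p - m)) = (\<Sum>m<p. x ^ Suc m)"
    by (rule sum.reindex_bij_witness[where i = "\<lambda>m. p - Suc m" and j = "\<lambda>m. p - Suc m"])
      (auto simp: Suc_diff_Suc simp flip: power_Suc)
  also have "\<dots> \<le> (\<Sum>m<p. x ^ m)" using x by (intro sum_mono) (auto simp: mult_le_cancel_right1)
  finally show ?thesis using geo by simp
qed

text \<open>
  The map \<open>t \<mapsto> t B\<close> permutes the residue vectors modulo \<open>p\<close>, which turns the sum into a product of
  one-dimensional ones. For \<open>t \<noteq> 0\<close> some coordinate of \<open>t B\<close> is nonzero modulo \<open>p\<close>, so half of the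
  exponent already yields the decaying factor, and the other half keeps the sum bounded.
\<close>

lemma gaussian_sum:
  fixes B :: "int ^ 'k ^ 'k"
  assumes p: "p > 0" "coprime (det B) (int p)" and s: "s \<ge> 2 * (real p)\<^sup>2"
  shows "(\<Sum>t\<in>residue_vectors p - {0}. exp (- (s * (\<Sum>j\<in>UNIV. (int_dist (of_int (dot (column j B) t) / of_nat p))\<^sup>2))))
           \<le> 4 ^ CARD('k) * exp (- (s / (2 * (real p)\<^sup>2)))"
proof -
  let ?R = "residue_vectors p :: (int ^ 'k) set"
  define Q where "Q v = (\<Sum>j\<in>UNIV. (int_dist (of_int (v $ j) / of_nat p))\<^sup>2)" for v :: "int ^ 'k"
  have s0: "0 \<le> s" using s by (meson order_trans zero_le_power2 mult_nonneg_nonneg zero_le_numeral)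
  define \<phi> where "\<phi> t = reduce_vec p (t v* B)" for t
  have Q\<phi>: "Q (\<phi> t) = Q (t v* B)" for t
    unfolding Q_def by (intro sum.cong refl arg_cong[of _ _ "\<lambda>x. x\<^sup>2"] int_dist_cong_mod)
      (simp add: \<phi>_def reduce_vec_def mod_eq_dvd_iff[symmetric])
  have "inj_on \<phi> ?R"
  proof (rule inj_onI)
    fix t u assume tu: "t \<in> ?R" "u \<in> ?R" "\<phi> t = \<phi> u"
    have d: "int p dvd ((t - u) v* B) $ i" for i
    proof -
      have "(t v* B) $ i mod int p = (u v* B) $ i mod int p"
        using tu(3) by (simp add: \<phi>_def reduce_vec_def vec_eq_iff)
      then have "int p dvd (t v* B) $ i - (u v* B) $ i" by (simp add: mod_eq_dvd_iff)
      then show ?thesis by (simp add: vector_matrix_nth dot_diff_right)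
    qed
    then show "t = u"
      using residue_vectors_eqI[OF tu(1,2) dvd_vec_if_dvd_vector_matrix[OF p(2) d]] by blast
  qed
  moreover have "\<phi> ` ?R \<subseteq> ?R" using p(1) by (auto simp: \<phi>_def)
  ultimately have bij: "bij_betw \<phi> ?R ?R"
    by (simp add: bij_betw_def endo_inj_surj)
  have half: "exp (- (s * Q (t v* B))) \<le> exp (- (s / (2 * (real p)\<^sup>2))) * exp (- (s / 2 * Q (t v* B)))"
    if t: "t \<in> ?R - {0}" for t
  proof -
    have "\<exists>i. \<not> int p dvd t $ i"
      using residue_vectors_eqI[of t p 0] t zero_in_residue_vectors[OF p(1)] by auto
    then obtain j where j: "\<not> int p dvd (t v* B) $ j"
      using dvd_vec_if_dvd_vector_matrix[OF p(2)] by blast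
    then have "1 / real p \<le> int_dist (of_int ((t v* B) $ j) / of_nat p)"
      using dvd_of_int_dist_less[OF p(1)] by (meson not_le)
    then have "(1 / real p)\<^sup>2 \<le> (int_dist (of_int ((t v* B) $ j) / of_nat p))\<^sup>2"
      by (intro power_mono) auto
    also have "\<dots> \<le> Q (t v* B)" unfolding Q_def by (rule member_le_sum) auto
    finally have "s * (1 / real p)\<^sup>2 \<le> s * Q (t v* B)" using s0 by (rule mult_left_mono)
    then show ?thesis by (simp add: power_divide flip: exp_add)
  qed
  have "(\<Sum>t\<in>?R - {0}. exp (- (s * Q (t v* B))))
      \<le> (\<Sum>t\<in>?R - {0}. exp (- (s / (2 * (real p)\<^sup>2))) * exp (- (s / 2 * Q (t v* B))))"
    by (rule sum_mono) (rule half)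
  also have "\<dots> \<le> exp (- (s / (2 * (real p)\<^sup>2))) * (\<Sum>t\<in>?R. exp (- (s / 2 * Q (t v* B))))"
    unfolding sum_distrib_left[symmetric] by (intro mult_left_mono sum_mono2) auto
  also have "(\<Sum>t\<in>?R. exp (- (s / 2 * Q (t v* B)))) = (\<Sum>v\<in>?R. exp (- (s / 2 * Q v)))"
    using sum.reindex_bij_betw[OF bij, of "\<lambda>v. exp (- (s / 2 * Q v))"] by (simp add: Q\<phi>)
  also have "\<dots> = (\<Prod>j\<in>(UNIV::'k set). \<Sum>m\<in>{0..<int p}. exp (- (s / 2 * (int_dist (of_int m / of_nat p))\<^sup>2)))"
    by (subst sum_prod_residue_vectors[symmetric])
      (simp add: Q_def sum_distrib_left sum_negf[symmetric] exp_sum del: sum_negf)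
  also have "\<dots> \<le> (\<Prod>j\<in>(UNIV::'k set). 4)"
    using s by (intro prod_mono conjI gaussian_sum_1d p(1) sum_nonneg) auto
  finally show ?thesis by (simp add: Q_def vector_matrix_nth mult.commute)
qed

section \<open>Convergence rate\<close>

lemma (in prob_space) sum_walk_law:
  fixes A :: "int ^ 'k ^ 'k" and b :: "nat \<Rightarrow> 'a \<Rightarrow> int ^ 'k"
  assumes b: "\<And>i. b i \<in> measurable M (count_space UNIV)" and p: "p > 0"
  shows "(\<Sum>x\<in>residue_vectors p. measure (walk_law M A b x0 p n) {x}) = 1"
proof -
  have "walk A b x0 p n \<omega> \<in> residue_vectors p" for \<omega>
    using p by (cases n) auto
  then have "(\<Sum>x\<in>residue_vectors p. of_real (measure (walk_law M A b x0 p n) {x}) * 1)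
      = expectation (\<lambda>\<omega>. (1 :: complex))"
    unfolding walk_law_def by (intro expectation_finite_range walk_measurable b) auto
  then have "of_real (\<Sum>x\<in>residue_vectors p. measure (walk_law M A b x0 p n) {x}) = (1 :: complex)"
    by (simp add: prob_space)
  then show ?thesis by (simp only: of_real_eq_1_iff)
qed

lemma variation_distance_le:
  fixes P :: "(int ^ 'k) measure"
  assumes p: "p > 0" and one: "(\<Sum>x\<in>residue_vectors p. measure P {x}) = 1"
    and le: "(\<Sum>t\<in>residue_vectors p - {0}. (cmod (\<Sum>x\<in>residue_vectors p. of_real (measure P {x}) * chi p t x))\<^sup>2)
      \<le> (2 * y)\<^sup>2" and y: "0 \<le> y"
  shows "variation_distance p P (uniform_law p) \<le> y"
proof -
  let ?R = "residue_vectors p :: (int ^ 'k) set"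
  have ne: "?R \<noteq> {}" using zero_in_residue_vectors[OF p] by blast
  have "measure (uniform_law p) {x} = 1 / real (p ^ CARD('k))" if "x \<in> ?R" for x
    using that ne by (simp add: uniform_law_def measure_pmf_single card_residue_vectors)
  then have "2 * variation_distance p P (uniform_law p) = (\<Sum>x\<in>?R. \<bar>measure P {x} - 1 / real (p ^ CARD('k))\<bar>)"
    by (simp add: variation_distance_def)
  also have "\<dots> \<le> 2 * y"
  proof (rule power2_le_imp_le)
    show "(\<Sum>x\<in>?R. \<bar>measure P {x} - 1 / real (p ^ CARD('k))\<bar>)\<^sup>2 \<le> (2 * y)\<^sup>2"
      by (rule order_trans[OF l1_distance_uniform_le_fourier[OF p one] le])
  qed (use y in simp)
  finally show ?thesis by simp
qed

text \<open>
  Each term is bounded by the sum of the bounds for the two classes of characters, so that both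
  sums may be extended over all \<open>t\<close>.
\<close>

lemma sum_exp_energy_le:
  fixes A B :: "int ^ 'k ^ 'k"
  assumes p: "p > 0" "coprime (det B) (int p)" and \<epsilon>: "\<epsilon> = 1 \<or> \<epsilon> = - 1"
    and \<beta>: "\<beta> > 0" and n: "real n \<ge> (real p)\<^sup>2 / \<beta>"
    and e: "\<And>t. \<not> (\<forall>i. int p dvd (t v* A - \<epsilon> *s t) $ i) \<Longrightarrow> e \<le> energy A B p n t"
  shows "(\<Sum>t\<in>residue_vectors p - {0}. (exp (- (\<beta> * energy A B p n t)))\<^sup>2)
    \<le> 4 ^ CARD('k) * exp (- (\<beta> * real n / (real p)\<^sup>2)) + real p ^ CARD('k) * exp (- (2 * \<beta> * e))"
proof -
  let ?R = "residue_vectors p :: (int ^ 'k) set"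
  let ?E = "\<lambda>t. \<forall>i. int p dvd (t v* A - \<epsilon> *s t) $ i"
  define Q where "Q t = (\<Sum>j\<in>UNIV. (int_dist (of_int (dot (column j B) t) / of_nat p))\<^sup>2)" for t
  have bound: "(exp (- (\<beta> * energy A B p n t)))\<^sup>2 \<le> exp (- (2 * \<beta> * n * Q t)) + exp (- (2 * \<beta> * e))" for t
  proof (cases "?E t")
    case True
    then have "energy A B p n t = n * Q t" unfolding Q_def by (intro energy_eigenvector[OF \<epsilon>]) auto
    then show ?thesis by (simp add: mult_ac flip: exp_double)
  next
    case False
    have "(exp (- (\<beta> * energy A B p n t)))\<^sup>2 = exp (- (2 * \<beta> * energy A B p n t))"
      by (simp add: mult_ac flip: exp_double)
    also have "\<dots> \<le> exp (- (2 * \<beta> * e))" using e[OF False] \<beta> by simp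
    finally show ?thesis by (simp add: add_increasing)
  qed
  have "(\<Sum>t\<in>?R - {0}. (exp (- (\<beta> * energy A B p n t)))\<^sup>2)
      \<le> (\<Sum>t\<in>?R - {0}. exp (- (2 * \<beta> * n * Q t))) + (\<Sum>t\<in>?R - {0}. exp (- (2 * \<beta> * e)))"
    unfolding sum.distrib[symmetric] by (rule sum_mono) (rule bound)
  also have "\<dots> \<le> 4 ^ CARD('k) * exp (- (2 * \<beta> * n / (2 * (real p)\<^sup>2))) + (\<Sum>t\<in>?R. exp (- (2 * \<beta> * e)))"
  proof (rule add_mono)
    have "2 * (real p)\<^sup>2 \<le> 2 * \<beta> * real n" using n \<beta> by (simp add: field_simps)
    then show "(\<Sum>t\<in>?R - {0}. exp (- (2 * \<beta> * n * Q t)))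
        \<le> 4 ^ CARD('k) * exp (- (2 * \<beta> * n / (2 * (real p)\<^sup>2)))"
      unfolding Q_def by (rule gaussian_sum[OF p])
  qed (intro sum_mono2, auto)
  finally show ?thesis by (simp add: card_residue_vectors)
qed

text \<open>
  The prefactor \<open>p\<^sup>k \<le> exp (k p)\<close> is absorbed by \<open>exp (- g n/p)\<close>, as \<open>n/p \<ge> c p\<close>, and the
  constant factor \<open>2\<close> from adding the two classes is absorbed by lowering the exponent. The
  summands of \<open>c\<close> correspond to the comparisons made in the proof.
\<close>

lemma exists_rate_constants:
  fixes \<beta> \<gamma> :: real and K d k :: nat
  assumes "\<beta> > 0" "\<gamma> > 0"
  shows "\<exists>\<alpha>>0. \<exists>c>0. \<forall>p n :: nat. p > 0 \<longrightarrow> real n \<ge> c * (real p)\<^sup>2 \<longrightarrow>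
     real (n - d) \<ge> (real p)\<^sup>2 / \<beta> \<and>
     4 ^ k * exp (- (\<beta> * real (n - d) / (real p)\<^sup>2))
       + real p ^ k * exp (- (2 * \<beta> * (\<gamma> * real ((n - d) div (K * p + 2)))))
     \<le> 4 ^ k * exp (- (2 * (\<alpha> * real n / (real p)\<^sup>2)))"
proof -
  define g where "g = 2 * \<beta> * \<gamma> / (4 * (real K + 2))"
  have g: "g > 0" using assms by (simp add: g_def)
  define \<alpha> where "\<alpha> = min (\<beta> / 8) (g / 8)"
  have \<alpha>: "\<alpha> > 0" "8 * \<alpha> \<le> \<beta>" "8 * \<alpha> \<le> g" using assms g by (auto simp: \<alpha>_def)
  define c where "c = 1 + 2 * real d + 2 / \<beta> + 4 * (real K + 2) + 2 * real k / g + 1 / (2 * \<alpha>)"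
  have pos: "0 \<le> 2 * real d" "0 \<le> 2 / \<beta>" "0 \<le> 4 * (real K + 2)" "0 \<le> 2 * real k / g" "0 \<le> 1 / (2 * \<alpha>)"
    using assms g \<alpha> by auto
  have c: "c \<ge> 1" "c \<ge> 2 * real d" "c \<ge> 2 / \<beta>" "c \<ge> 4 * (real K + 2)" "c \<ge> 2 * real k / g" "c \<ge> 1 / (2 * \<alpha>)"
    unfolding c_def using pos by linarith+
  have main: "real (n - d) \<ge> (real p)\<^sup>2 / \<beta> \<and>
     4 ^ k * exp (- (\<beta> * real (n - d) / (real p)\<^sup>2))
       + real p ^ k * exp (- (2 * \<beta> * (\<gamma> * real ((n - d) div (K * p + 2)))))
     \<le> 4 ^ k * exp (- (2 * (\<alpha> * real n / (real p)\<^sup>2)))"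
    if p: "p > 0" and n: "real n \<ge> c * (real p)\<^sup>2" for p n :: nat
  proof -
    define u where "u = real n / (real p)\<^sup>2"
    define v where "v = real n / real p"
    have p1: "1 \<le> real p" using p by simp
    then have p2: "real p \<le> (real p)\<^sup>2" "1 \<le> (real p)\<^sup>2" by (simp_all add: power2_eq_square mult_ge1_I)
    have cu: "c \<le> u" using n p by (simp add: u_def field_simps)
    have uv: "u \<le> v" unfolding u_def v_def using p2 p1 by (intro divide_left_mono) auto
    have cpv: "c * real p \<le> v" using n p by (simp add: v_def field_simps power2_eq_square)
    have "2 * real d * 1 \<le> c * (real p)\<^sup>2" using c p2 by (intro mult_mono) auto
    then have d: "2 * real d \<le> real n" using n by linarith
    then have nd: "real n / 2 \<le> real (n - d)" by (simp add: of_nat_diff)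
    have "2 / \<beta> * (real p)\<^sup>2 \<le> c * (real p)\<^sup>2" using c by (intro mult_right_mono) auto
    then have 1: "real (n - d) \<ge> (real p)\<^sup>2 / \<beta>" using n nd by (simp add: field_simps)
    have "4 * \<alpha> * u \<le> \<beta> * real (n - d) / (real p)\<^sup>2"
    proof -
      have "4 * \<alpha> * real n \<le> \<beta> * real (n - d)"
        using mult_mono[OF \<alpha>(2) nd] assms by (simp add: field_simps)
      then show ?thesis unfolding u_def using p by (simp add: divide_right_mono)
    qed
    then have A: "4 ^ k * exp (- (\<beta> * real (n - d) / (real p)\<^sup>2)) \<le> 4 ^ k * exp (- (4 * \<alpha> * u))"
      by simp
    define W where "W = K * p + 2"
    have W: "W > 0" "real W \<le> (real K + 2) * real p" using p1 by (auto simp: W_def algebra_simps)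
    define h where "h = v / (4 * (real K + 2))"
    have "h \<le> real ((n - d) div W)"
    proof -
      have "real n / 2 / ((real K + 2) * real p) \<le> real (n - d) / real W"
        using W nd by (intro frac_le) auto
      also have "real (n - d) / real W \<le> real ((n - d) div W) + 1"
        using floor_divide_of_nat_eq[of "n - d" W, where ?'a = real] by linarith
      finally have "v / (2 * (real K + 2)) \<le> real ((n - d) div W) + 1"
        by (simp add: v_def field_simps)
      moreover have "1 \<le> h"
      proof -
        have "4 * (real K + 2) * 1 \<le> c * real p" using c p1 by (intro mult_mono) auto
        then show ?thesis using cpv by (simp add: h_def field_simps)
      qed
      moreover have "v / (2 * (real K + 2)) = 2 * h" by (simp add: h_def field_simps)
      ultimately show ?thesis by linarith
    qed
    then have "2 * \<beta> * \<gamma> * h \<le> 2 * \<beta> * \<gamma> * real ((n - d) div W)"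
      using assms by (intro mult_left_mono) auto
    then have gv: "g * v \<le> 2 * \<beta> * (\<gamma> * real ((n - d) div W))" by (simp add: g_def h_def mult.assoc)
    have "real p ^ k \<le> exp (g * v / 2)"
    proof -
      have "real p \<le> exp (real p)" using exp_ge_add_one_self[of "real p"] by linarith
      then have "real p ^ k \<le> exp (real p) ^ k" by (intro power_mono) auto
      also have "\<dots> = exp (real k * real p)" by (rule exp_of_nat_mult[symmetric])
      also have "\<dots> \<le> exp (g * v / 2)"
      proof -
        have "2 * real k / g * real p \<le> c * real p" using c by (intro mult_right_mono) auto
        then have "2 * real k / g * real p \<le> v" using cpv by linarith
        then show ?thesis using g by (simp add: field_simps)
      qed
      finally show ?thesis .
    qed
    then have "real p ^ k * exp (- (2 * \<beta> * (\<gamma> * real ((n - d) div W)))) \<le> exp (g * v / 2) * exp (- (g * v))"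
      using gv by (intro mult_mono) auto
    also have "\<dots> = exp (- (g * v / 2))" by (simp flip: exp_add)
    also have "\<dots> \<le> exp (- (4 * \<alpha> * u))"
    proof -
      have "8 * \<alpha> * u \<le> g * v" using \<alpha> uv g c(1) cu by (intro mult_mono) auto
      then show ?thesis by simp
    qed
    also have "\<dots> \<le> 4 ^ k * exp (- (4 * \<alpha> * u))" by simp
    finally have B: "real p ^ k * exp (- (2 * \<beta> * (\<gamma> * real ((n - d) div W)))) \<le> 4 ^ k * exp (- (4 * \<alpha> * u))" .
    have "2 * exp (- (2 * \<alpha> * u)) \<le> 1"
    proof -
      have "1 / (2 * \<alpha>) \<le> u" using c(6) cu by linarith
      then have "1 \<le> 2 * \<alpha> * u" using \<alpha>(1) by (simp add: field_simps)
      then have "2 \<le> exp (2 * \<alpha> * u)"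
        using exp_ge_add_one_self[of "2 * \<alpha> * u"] by linarith
      then show ?thesis by (simp add: exp_minus field_simps)
    qed
    then have "(4 ^ k * exp (- (2 * \<alpha> * u))) * (2 * exp (- (2 * \<alpha> * u))) \<le> (4 ^ k * exp (- (2 * \<alpha> * u))) * 1"
      by (intro mult_left_mono) auto
    moreover have "exp (- (4 * \<alpha> * u)) = exp (- (2 * \<alpha> * u)) * exp (- (2 * \<alpha> * u))"
      by (simp flip: exp_add)
    ultimately have "2 * (4 ^ k * exp (- (4 * \<alpha> * u))) \<le> 4 ^ k * exp (- (2 * \<alpha> * u))"
      by (simp add: mult_ac)
    then have "4 ^ k * exp (- (\<beta> * real (n - d) / (real p)\<^sup>2))
        + real p ^ k * exp (- (2 * \<beta> * (\<gamma> * real ((n - d) div W)))) \<le> 4 ^ k * exp (- (2 * \<alpha> * u))"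
      using A B by linarith
    moreover have "2 * \<alpha> * u = 2 * (\<alpha> * real n / (real p)\<^sup>2)" by (simp add: u_def)
    ultimately show ?thesis using 1 by (simp only: W_def)
  qed
  have "c > 0" using c by linarith
  with \<alpha> main show ?thesis by blast
qed

theorem theorem3p9:
  fixes A B :: "int ^ 'k ^ 'k"
    and q :: "rat poly"
    and d :: nat
    and ev :: "nat \<Rightarrow> complex"
    and \<mu> :: "(int ^ 'k) pmf"
    and M :: "'w measure"
    and b :: "nat \<Rightarrow> 'w \<Rightarrow> int ^ 'k"
    and x0 :: "int ^ 'k"
  assumes A: "invertible (rat_mat A)"
    and minpoly: "is_minimum_poly (rat_mat A) q"
    and degree: "d = degree q"
    and eigenvalues:
      "charpoly (map_matrix complex_of_int A) = (\<Prod>i=1..CARD('k). [:- ev i, 1:])"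
    and minpoly_roots: "map_poly of_rat q = (\<Prod>i=1..d. [:- ev i, 1:])"
    and nonzero: "\<forall>i\<in>{1..CARD('k)}. ev i \<noteq> 0"
    and roots_of_integers:
      "\<forall>i\<in>{1..CARD('k)}. \<exists>l\<ge>1. \<exists>m::int. m > 0 \<and> ev i ^ l = of_int m"
    and unit: "cmod (ev 1) = 1"
    and expanding: "\<forall>i\<in>{2..d}. cmod (ev i) > 1"
    and support:
      "\<not> (\<exists>W. vec.subspace W \<and> W \<noteq> UNIV \<and> invariant_under (rat_mat A) W
             \<and> parallel_to (set_pmf \<mu>) W)"
    and prob: "prob_space M"
    and indep: "prob_space.indep_vars M (\<lambda>_. count_space UNIV) b UNIV"
    and law: "\<forall>n. distr M (count_space UNIV) (b n) = measure_pmf \<mu>"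
    and B_columns: "\<forall>j. column j B \<in> iterated_differences A d \<mu>"
    and B_basis: "columns_form_basis B"
  shows "\<exists>\<alpha> c :: real. \<exists>N :: nat. \<alpha> > 0 \<and> c > 0 \<and>
    (\<forall>p :: nat. p > N \<longrightarrow> gcd (det A) (int p) = 1 \<longrightarrow> gcd (det B) (int p) = 1 \<longrightarrow>
      (\<forall>n :: nat. real n \<ge> c * (real p)\<^sup>2 \<longrightarrow>
        variation_distance p (walk_law M A b x0 p n) (uniform_law p)
          \<le> 2 ^ (CARD('k) - 1) * exp (- (\<alpha> * real n / (real p)\<^sup>2))))"
proof -
  interpret prob_space M by (rule prob)
  have b: "b i \<in> measurable M (count_space UNIV)" for i
    using indep by (auto simp: indep_vars_def)
  \<comment> \<open>For \<open>d = 0\<close> there would be no iterated differences to serve as columns.\<close>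
  have "d \<ge> 1"
  proof -
    from B_columns have "column undefined B \<in> iterated_differences A d \<mu>" ..
    then show ?thesis by (auto simp: iterated_differences_def)
  qed
  \<comment> \<open>The minimum polynomial is \<open>(X - \<epsilon>) r\<close> with \<open>r\<close> expanding.\<close>
  obtain \<epsilon> r where \<epsilon>: "\<epsilon> = 1 \<or> \<epsilon> = - 1"
    and r: "map_poly of_rat r = (\<Prod>i=2..d. [:- ev i, 1:])" "q = [:- of_int \<epsilon>, 1:] * r"
    using unit_root_splits_off[OF minpoly_roots \<open>d \<ge> 1\<close> unit] expanding by metis
  have q0: "poly_mat q (rat_mat A) = 0"
    using minpoly by (simp add: is_minimum_poly_def)
  obtain \<beta> where \<beta>: "\<beta> > 0" and decay: "\<And>p n t. (\<Prod>i<n. cmod (measure_pmf.expectation \<mu> (chi p (adj_iter A i t))))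
           \<le> exp (- (\<beta> * energy A B p (n - d) t))"
    using fourier_decay[OF B_columns] by blast
  obtain \<gamma> K where \<gamma>: "\<gamma> > 0" and exp: "\<And>p n t. p > 0 \<Longrightarrow> coprime (det A) (int p) \<Longrightarrow> coprime (det B) (int p) \<Longrightarrow>
           \<not> (\<forall>i. int p dvd (t v* A - \<epsilon> *s t) $ i) \<Longrightarrow>
              \<gamma> * real (n div (K * p + 2)) \<le> energy A B p n t"
    using energy_expanding[OF q0 r(2) \<epsilon> r(1), of B] expanding by (metis finite_atLeastAtMost)
  obtain \<alpha> c where \<alpha>c: "\<alpha> > 0" "c > 0" and rates: "\<And>p n :: nat. p > 0 \<Longrightarrow> real n \<ge> c * (real p)\<^sup>2 \<Longrightarrow>
     real (n - d) \<ge> (real p)\<^sup>2 / \<beta> \<and>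
     4 ^ CARD('k) * exp (- (\<beta> * real (n - d) / (real p)\<^sup>2))
       + real p ^ CARD('k) * exp (- (2 * \<beta> * (\<gamma> * real ((n - d) div (K * p + 2)))))
     \<le> 4 ^ CARD('k) * exp (- (2 * (\<alpha> * real n / (real p)\<^sup>2)))"
    using exists_rate_constants[OF \<beta> \<gamma>, of d "CARD('k)" K] by metis
  have "variation_distance p (walk_law M A b x0 p n) (uniform_law p)
          \<le> 2 ^ (CARD('k) - 1) * exp (- (\<alpha> * real n / (real p)\<^sup>2))"
    if p: "p > 0" "gcd (det A) (int p) = 1" "gcd (det B) (int p) = 1" and n: "real n \<ge> c * (real p)\<^sup>2" for p n
  proof (rule variation_distance_le[OF p(1) sum_walk_law[OF b p(1)]])
    have cop: "coprime (det A) (int p)" "coprime (det B) (int p)"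
      using p by (simp_all add: coprime_iff_gcd_eq_1)
    have "(\<Sum>t\<in>residue_vectors p - {0}. (cmod (\<Sum>x\<in>residue_vectors p. of_real (measure (walk_law M A b x0 p n) {x}) * chi p t x))\<^sup>2)
        \<le> (\<Sum>t\<in>residue_vectors p - {0}. (exp (- (\<beta> * energy A B p (n - d) t)))\<^sup>2)"
      by (intro sum_mono power_mono) (simp_all add: fourier_walk_law[OF indep _ p(1)] law decay prod_nonneg)
    also have "\<dots> \<le> 4 ^ CARD('k) * exp (- (\<beta> * real (n - d) / (real p)\<^sup>2))
       + real p ^ CARD('k) * exp (- (2 * \<beta> * (\<gamma> * real ((n - d) div (K * p + 2)))))"
      using rates[OF p(1) n] by (intro sum_exp_energy_le[OF p(1) cop(2) \<epsilon> \<beta>] exp[OF p(1) cop]) auto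
    also have "\<dots> \<le> 4 ^ CARD('k) * exp (- (2 * (\<alpha> * real n / (real p)\<^sup>2)))"
      using rates[OF p(1) n] by blast
    also have "\<dots> = (2 ^ CARD('k) * exp (- (\<alpha> * real n / (real p)\<^sup>2)))\<^sup>2"
    proof -
      have exp2: "exp (- (2 * z)) = exp (- z) * exp (- z)" for z :: real by (simp flip: exp_add)
      have four: "(4 :: real) ^ CARD('k) = 2 ^ CARD('k) * 2 ^ CARD('k)"
        by (simp flip: power_mult_distrib)
      show ?thesis unfolding four exp2 power2_eq_square[of "2 ^ _ * _"] by (simp only: mult_ac)
    qed
    also have "2 ^ CARD('k) = (2 :: real) * 2 ^ (CARD('k) - 1)"
      by (simp flip: power_Suc)
    finally show "(\<Sum>t\<in>residue_vectors p - {0}. (cmod (\<Sum>x\<in>residue_vectors p. of_real (measure (walk_law M A b x0 p n) {x}) * chi p t x))\<^sup>2)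
      \<le> (2 * (2 ^ (CARD('k) - 1) * exp (- (\<alpha> * real n / (real p)\<^sup>2))))\<^sup>2"
      by (simp only: mult.assoc)
  qed simp
  with \<alpha>c show ?thesis by (intro exI[of _ \<alpha>] exI[of _ c] exI[of _ 0]) auto
qed

end
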